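(* Let $\lambda>0$ and $\tau=\frac{\lambda}{(1+\lambda)^2}\in(0,\frac14]$. With the elements $e_n,f_n,g_n,v_n,w_n$ of the AF algebra $\mathfrak A$ defined in the context, set $$E_n=\frac1{1+\lambda}\bigl(v_n^*v_n+\sqrt\lambda\,v_n+\sqrt\lambda\,v_n^*+\lambda v_nv_n^*\bigr),\quad n\ge0,$$ $$F_n=\frac1{1+\lambda}\bigl(w_n^*w_n+\sqrt\lambda\,w_n+\sqrt\lambda\,w_n^*+\lambda w_nw_n^*\bigr),\quad n\ge1.$$ Then all $E_n$ and $F_n$ are (self-adjoint) projections in $\mathfrak A$, and the following relations hold for all indices $n,m$ for which the elements involved are defined: 1. $E_nF_n=F_nE_n=0$; 2. $[E_n,E_m]=[F_n,F_m]=[E_n,F_m]=0$ if $|n-m|\ge2$; 3. $E_nE_{n+1}E_n=\tau E_ne_{n+2}$ and $E_{n+1}E_nE_{n+1}=\tau E_{n+1}g_n$; 4. $F_nF_{n+1}F_n=\tau F_nf_{n+2}$ and $F_{n+1}F_nF_{n+1}=\tau F_{n+1}g_n$; 5. $E_nF_{n+1}E_n=\lambda\tau E_nf_{n+2}$ and $F_nE_{n+1}F_n=\lambda\tau F_ne_{n+2}$; 6. $E_{n+1}F_nE_{n+1}=\lambda\tau E_{n+1}e_n$ and $F_{n+1}E_nF_{n+1}=\lambda\tau F_{n+1}f_n$; 7. $E_nE_{n+1}F_n=E_nF_{n+1}F_n=E_{n+1}E_nF_{n+1}=E_{n+1}F_nF_{n+1}=0$; 8. $F_nE_{n+1}E_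n=F_nF_{n+1}E_n=F_{n+1}E_nE_{n+1}=F_{n+1}F_nE_{n+1}=0$.
   Context: Path model of $\mathfrak A$. Let $\widetilde{\mathcal G}$ be the graph with vertices $(n,k)$, $n\ge0$, $0\le k\le2^n$ (floor $n$), together with one vertex $\star=(-1,0)$ on floor $-1$. For $n\ge 0$ there is a single edge from $(n,k)$ to $(n+1,\ell)$ exactly when $|2k-\ell|\le1$; $\star$ is joined by a single edge to each of $(0,0)$ and $(0,1)$; there are no other edges. Let $\Omega$ be the set of infinite monotone paths $\xi=(\xi_{-1}=0,\xi_0,\xi_1,\dots)$ starting at $\star$, where $\xi_n$ is the horizontal coordinate of the vertex $(n,\xi_n)$ on floor $n$, and let $\Omega_{r]}$ be the set of finite paths $(\xi_{-1},\dots,\xi_r)$ from $\star$ to floor $r$. For $\xi,\eta\in\Omega_{r]}$ with the same endpoint $\xi_r=\eta_r$, let $T_{\xi,\eta}$ be the operator on $\ell^2(\Omega)$ which maps a basis path $\omega$ whose truncation to floors $-1,\dots,r$ equals $\eta$ to the path obtained by replacing this initial segment with $\xi$, and maps all other basis paths to $0$. Let $\mathfrak A_r$ be the linear span of all such $T_{\xi,\eta}$ (a finite-dimensional $C^*$-algebra), with $\mathfrak A_r\subseteq\mathfrak A_{r+1}$, and let $\mathfrak A$ be the norm closure of $\bigcup_r\mathfrak A_r$. (This is the AF algebra whose Bratteli diagram is the Pascal triangle with memory.) An edge from $(n-1,i)$ to $(n,2i-1)$ is of type SW, to $(n,2i)$ of type S, and to $(n,2i+1)$ of type SE (for $n=0$: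 $\star\to(0,0)$ is of type S and $\star\to(0,1)$ is of type SE). $e_n$ ($n\ge1$) is the projection onto the closed span of the paths $\omega\in\Omega$ whose edge from floor $n-1$ to floor $n$ is of type SW; $f_n$ ($n\ge0$) is the same with SE; $g_n=1-e_n-f_n$ (with $e_0=0$) is the same with S, $n\ge0$. $v_n\in\mathfrak A_{n+1}$ ($n\ge0$) is the partial isometry with $v_n^*v_n=g_nf_{n+1}$ and $v_nv_n^*=f_ne_{n+1}$ which flips paths: it maps a path passing through $(n-1,i),(n,2i),(n+1,4i+1)$ to the path that passes through $(n-1,i),(n,2i+1),(n+1,4i+1)$ and is otherwise the same, and annihilates all paths not of the first form. $w_n\in\mathfrak A_{n+1}$ ($n\ge1$) is the partial isometry with $w_n^*w_n=g_ne_{n+1}$ and $w_nw_n^*=e_nf_{n+1}$ which flips paths: it maps a path passing through $(n-1,i),(n,2i),(n+1,4i-1)$ to the path that passes through $(n-1,i),(n,2i-1),(n+1,4i-1)$ and is otherwise the same, and annihilates all paths not of the first form. $[a,b]=ab-ba$. *)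

theory Defs
  imports "HOL-Analysis.Analysis"
begin

section \<open>The Hilbert space of square-summable functions\<close>

class complex_vector = real_vector +
  fixes scaleC :: "complex \<Rightarrow> 'a \<Rightarrow> 'a" (infixr "*\<^sub>C" 75)
  assumes scaleC_add_right: "c *\<^sub>C (x + y) = c *\<^sub>C x + c *\<^sub>C y"
    and scaleC_add_left: "(c + d) *\<^sub>C x = c *\<^sub>C x + d *\<^sub>C x"
    and scaleC_scaleC: "c *\<^sub>C d *\<^sub>C x = (c * d) *\<^sub>C x"
    and scaleR_eq_scaleC: "r *\<^sub>R x = complex_of_real r *\<^sub>C x"

lemma scaleC_one: "1 *\<^sub>C x = (x :: 'a::complex_vector)"
  using scaleR_eq_scaleC[of 1 x] by simp

lemma vector_space_scaleC: "vector_space (scaleC :: complex \<Rightarrow> 'a \<Rightarrow> 'a::complex_vector)"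
  by unfold_locales (simp_all add: scaleC_add_right scaleC_add_left scaleC_scaleC scaleC_one)

definition cspan :: "'a::complex_vector set \<Rightarrow> 'a set"
  where "cspan = module.span scaleC"

typedef 'a ell2 = "{x :: 'a \<Rightarrow> complex. (\<lambda>i. (cmod (x i))\<^sup>2) summable_on UNIV}"
  morphisms ell2_nth Ell2
  by (rule exI[of _ "\<lambda>_. 0"]) simp

setup_lifting type_definition_ell2

lemma summable_on_cmod_scale:
  assumes "(\<lambda>i. (cmod (x i))\<^sup>2) summable_on A"
  shows "(\<lambda>i. (cmod (c * x i))\<^sup>2) summable_on A"
  using summable_on_cmult_right[OF assms, of "(cmod c)\<^sup>2"] by (simp add: norm_mult power_mult_distrib)

lemma summable_on_cmod_add:
  assumes "(\<lambda>i. (cmod (x i))\<^sup>2) summable_on A" "(\<lambda>i. (cmod (y i))\<^sup>2) summable_on A"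
  shows "(\<lambda>i. (cmod (x i + y i))\<^sup>2) summable_on A"
proof (rule summable_on_comparison_test)
  show "(\<lambda>i. 2 * (cmod (x i))\<^sup>2 + 2 * (cmod (y i))\<^sup>2) summable_on A"
    by (intro summable_on_add summable_on_cmult_right assms)
  show "(cmod (x i + y i))\<^sup>2 \<le> 2 * (cmod (x i))\<^sup>2 + 2 * (cmod (y i))\<^sup>2" for i
  proof -
    have "(cmod (x i + y i))\<^sup>2 \<le> (cmod (x i) + cmod (y i))\<^sup>2"
      by (intro power_mono norm_triangle_ineq) simp
    also have "\<dots> \<le> 2 * (cmod (x i))\<^sup>2 + 2 * (cmod (y i))\<^sup>2"
      using sum_squares_bound[of "cmod (x i)" "cmod (y i)"] by (simp add: power2_sum)
    finally show ?thesis .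
  qed
qed simp

lemma abs_summable_on_cmod_mult:
  assumes "(\<lambda>i. (cmod (x i))\<^sup>2) summable_on A" "(\<lambda>i. (cmod (y i))\<^sup>2) summable_on A"
  shows "(\<lambda>i. norm (cnj (x i) * y i)) summable_on A"
proof (rule summable_on_comparison_test)
  show "(\<lambda>i. (cmod (x i))\<^sup>2 + (cmod (y i))\<^sup>2) summable_on A"
    by (intro summable_on_add assms)
  show "norm (cnj (x i) * y i) \<le> (cmod (x i))\<^sup>2 + (cmod (y i))\<^sup>2" for i
  proof -
    have "0 \<le> cmod (x i) * cmod (y i)" by simp
    then show ?thesis
      using sum_squares_bound[of "cmod (x i)" "cmod (y i)"]
      unfolding norm_mult complex_mod_cnj by linarith
  qed
qed simp

lift_definition cinner :: "'a ell2 \<Rightarrow> 'a ell2 \<Rightarrow> complex"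
  is "\<lambda>x y. \<Sum>\<^sub>\<infinity>i. cnj (x i) * y i" .

instantiation ell2 :: (type) complex_vector
begin

lift_definition zero_ell2 :: "'a ell2" is "\<lambda>_. 0" by simp
lift_definition plus_ell2 :: "'a ell2 \<Rightarrow> 'a ell2 \<Rightarrow> 'a ell2" is "\<lambda>x y i. x i + y i"
  by (rule summable_on_cmod_add)
lift_definition uminus_ell2 :: "'a ell2 \<Rightarrow> 'a ell2" is "\<lambda>x i. - x i"
  by simp
lift_definition minus_ell2 :: "'a ell2 \<Rightarrow> 'a ell2 \<Rightarrow> 'a ell2" is "\<lambda>x y i. x i - y i"
  subgoal for x y using summable_on_cmod_add[of x UNIV "\<lambda>i. - y i"] by simp
  done
lift_definition scaleC_ell2 :: "complex \<Rightarrow> 'a ell2 \<Rightarrow> 'a ell2" is "\<lambda>c x i. c * x i"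
  by (rule summable_on_cmod_scale)
lift_definition scaleR_ell2 :: "real \<Rightarrow> 'a ell2 \<Rightarrow> 'a ell2" is "\<lambda>c x i. complex_of_real c * x i"
  by (rule summable_on_cmod_scale)

instance
  by standard (transfer; simp add: algebra_simps)+

end

lemma ell2_nth_simps [simp]:
  "ell2_nth 0 i = 0"
  "ell2_nth (x + y) i = ell2_nth x i + ell2_nth y i"
  "ell2_nth (- x) i = - ell2_nth x i"
  "ell2_nth (x - y) i = ell2_nth x i - ell2_nth y i"
  "ell2_nth (c *\<^sub>C x) i = c * ell2_nth x i"
  "ell2_nth (r *\<^sub>R x) i = complex_of_real r * ell2_nth x i"
  by (transfer; simp)+

lemma ell2_eqI: "(\<And>i. ell2_nth x i = ell2_nth y i) \<Longrightarrow> x = y"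
  by (metis ell2_nth_inject ext)

lemma ell2_nth_summable: "(\<lambda>i. (cmod (ell2_nth x i))\<^sup>2) summable_on A"
  by (rule summable_on_subset_banach[of _ UNIV]) (use ell2_nth[of x] in simp_all)

lemma cinner_summable: "(\<lambda>i. cnj (ell2_nth x i) * ell2_nth y i) summable_on A"
  by (rule abs_summable_summable[OF abs_summable_on_cmod_mult[OF ell2_nth_summable ell2_nth_summable]])

lemma cinner_add_left: "cinner (x + y) z = cinner x z + cinner y z"
  by (simp add: cinner.rep_eq distrib_right infsum_add cinner_summable)

lemma cinner_add_right: "cinner x (y + z) = cinner x y + cinner x z"
  by (simp add: cinner.rep_eq distrib_left infsum_add cinner_summable)

lemma cinner_scaleC_left: "cinner (c *\<^sub>C x) y = cnj c * cinner x y"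
  by (simp add: cinner.rep_eq mult.assoc infsum_cmult_right')

lemma cinner_scaleC_right: "cinner x (c *\<^sub>C y) = c * cinner x y"
  by (simp add: cinner.rep_eq mult.left_commute infsum_cmult_right')

lemma cinner_commute: "cinner y x = cnj (cinner x y)"
  unfolding cinner.rep_eq by (simp add: mult.commute flip: infsum_cnj)

lemma cinner_self: "cinner x x = complex_of_real (\<Sum>\<^sub>\<infinity>i. (cmod (ell2_nth x i))\<^sup>2)"
proof -
  have "cinner x x = (\<Sum>\<^sub>\<infinity>i. complex_of_real ((cmod (ell2_nth x i))\<^sup>2))"
    by (simp only: cinner.rep_eq complex_norm_square mult.commute)
  also have "\<dots> = complex_of_real (\<Sum>\<^sub>\<infinity>i. (cmod (ell2_nth x i))\<^sup>2)"
    by (rule infsumI) (rule has_sum_of_real[OF has_sum_infsum[OF ell2_nth_summable]])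
  finally show ?thesis .
qed

instantiation ell2 :: (type) real_inner
begin

definition inner_ell2 :: "'a ell2 \<Rightarrow> 'a ell2 \<Rightarrow> real" where "inner_ell2 x y = Re (cinner x y)"
definition norm_ell2 :: "'a ell2 \<Rightarrow> real" where "norm_ell2 x = sqrt (Re (cinner x x))"
definition sgn_ell2 :: "'a ell2 \<Rightarrow> 'a ell2" where "sgn_ell2 x = inverse (norm x) *\<^sub>R x"
definition dist_ell2 :: "'a ell2 \<Rightarrow> 'a ell2 \<Rightarrow> real" where "dist_ell2 x y = norm (x - y)"
definition uniformity_ell2 :: "('a ell2 \<times> 'a ell2) filter"
  where "uniformity_ell2 = (INF e\<in>{0<..}. principal {(x, y). dist x y < e})"
definition open_ell2 :: "'a ell2 set \<Rightarrow> bool"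
  where "open_ell2 U = (\<forall>x\<in>U. eventually (\<lambda>(x', y). x' = x \<longrightarrow> y \<in> U) uniformity)"

instance
proof
  fix x y z :: "'a ell2" and r :: real and U :: "'a ell2 set"
  show "dist x y = norm (x - y)" by (rule dist_ell2_def)
  show "sgn x = inverse (norm x) *\<^sub>R x" by (rule sgn_ell2_def)
  show "uniformity = (INF e\<in>{0<..}. principal {(x, y::'a ell2). dist x y < e})"
    by (rule uniformity_ell2_def)
  show "open U = (\<forall>x\<in>U. eventually (\<lambda>(x', y). x' = x \<longrightarrow> y \<in> U) uniformity)"
    by (rule open_ell2_def)
  show "inner x y = inner y x"
    unfolding inner_ell2_def by (subst cinner_commute) simp
  show "inner (x + y) z = inner x z + inner y z"
    by (simp add: inner_ell2_def cinner_add_left)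
  show "inner (r *\<^sub>R x) y = r * inner x y"
    by (simp add: inner_ell2_def scaleR_eq_scaleC cinner_scaleC_left)
  show "0 \<le> inner x x"
    by (simp add: inner_ell2_def cinner_self infsum_nonneg)
  show "norm x = sqrt (inner x x)"
    by (simp add: inner_ell2_def norm_ell2_def)
  show "inner x x = 0 \<longleftrightarrow> x = 0"
  proof
    assume "inner x x = 0"
    then have "(\<Sum>\<^sub>\<infinity>i. (cmod (ell2_nth x i))\<^sup>2) = 0"
      by (simp add: inner_ell2_def cinner_self)
    then have "(cmod (ell2_nth x i))\<^sup>2 = 0" for i
      using nonneg_infsum_le_0D[of "\<lambda>i. (cmod (ell2_nth x i))\<^sup>2" UNIV i] ell2_nth_summable[of x UNIV]
      by simp
    then show "x = 0" by (intro ell2_eqI) simp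
  qed (simp add: inner_ell2_def cinner_self)
qed

end

lemma norm_ell2_square: "(norm x)\<^sup>2 = (\<Sum>\<^sub>\<infinity>i. (cmod (ell2_nth x i))\<^sup>2)"
  by (simp add: norm_ell2_def cinner_self infsum_nonneg)

lemma cinner_norm: "cinner x x = complex_of_real ((norm x)\<^sup>2)"
  by (simp add: cinner_self norm_ell2_square)

lemma norm_scaleC_ell2: "norm (c *\<^sub>C x) = cmod c * norm (x :: 'a ell2)"
proof -
  have "(norm (c *\<^sub>C x))\<^sup>2 = (cmod c * norm x)\<^sup>2"
    by (simp add: norm_ell2_square power_mult_distrib norm_mult infsum_cmult_right')
  then show ?thesis by (simp add: power2_eq_iff_nonneg)
qed

lemma cmod_cinner_le: "cmod (cinner x y) \<le> norm x * norm y"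
proof (cases "cinner x y = 0")
  case False
  define c where "c = cnj (cinner x y) / cmod (cinner x y)"
  have "cmod c = 1" using False by (simp add: c_def norm_divide)
  have "cinner x (c *\<^sub>C y) = cmod (cinner x y)"
    using False by (simp add: cinner_scaleC_right c_def mult.commute[of "cnj _"]
        complex_norm_square[symmetric] power2_eq_square)
  then have "cmod (cinner x y) = inner x (c *\<^sub>C y)"
    by (simp add: inner_ell2_def)
  also have "\<dots> \<le> norm x * norm (c *\<^sub>C y)"
    by (rule norm_cauchy_schwarz)
  finally show ?thesis by (simp add: norm_scaleC_ell2 \<open>cmod c = 1\<close>)
qed simp

lemma cinner_eqI:
  assumes "\<And>x. cinner x y = cinner x z"
  shows "y = z"
proof -
  have "cinner (y - z) y = cinner (y - z) (y - z) + cinner (y - z) z"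
    by (simp flip: cinner_add_right)
  with assms[of "y - z"] show ?thesis by (simp add: cinner_norm)
qed

lemma cinner_eqI_left:
  assumes "\<And>z. cinner x z = cinner y z"
  shows "x = y"
  by (rule cinner_eqI, subst (1 2) cinner_commute) (simp add: assms)

lift_definition ket :: "'a \<Rightarrow> 'a ell2" is "\<lambda>a i. if i = a then 1 else 0"
proof -
  fix a :: 'a
  have "(\<lambda>i. (cmod (if i = a then 1 else 0))\<^sup>2) summable_on {a}"
    by (rule summable_on_finite) simp
  then show "(\<lambda>i. (cmod (if i = a then 1 else 0))\<^sup>2) summable_on UNIV"
    by (rule summable_on_cong_neutral[THEN iffD1, rotated -1]) auto
qed

lemma ell2_nth_ket: "ell2_nth (ket a) i = (if i = a then 1 else 0)"
  by transfer simp

lemma cinner_ket: "cinner (ket a) x = ell2_nth x a"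
proof -
  have "cinner (ket a) x = (\<Sum>\<^sub>\<infinity>i\<in>{a}. cnj (ell2_nth (ket a) i) * ell2_nth x i)"
    unfolding cinner.rep_eq by (rule infsum_cong_neutral) (auto simp: ell2_nth_ket)
  also have "\<dots> = ell2_nth x a"
    by (subst infsum_finite) (simp_all add: ell2_nth_ket)
  finally show ?thesis .
qed

lemma norm_ket: "norm (ket a) = 1"
  by (simp add: norm_ell2_def cinner_ket ell2_nth_ket)

lifting_forget ell2.lifting

section \<open>Bounded operators\<close>

typedef 'a bop = "{A :: 'a ell2 \<Rightarrow>\<^sub>L 'a ell2. \<forall>c x. blinfun_apply A (c *\<^sub>C x) = c *\<^sub>C blinfun_apply A x}"
  morphisms blinfun_of_bop Bop
  by (rule exI[of _ id_blinfun]) simp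

setup_lifting type_definition_bop

lift_definition bop_apply :: "'a bop \<Rightarrow> 'a ell2 \<Rightarrow> 'a ell2" is blinfun_apply .

lemma bop_eqI: "(\<And>x. bop_apply A x = bop_apply B x) \<Longrightarrow> A = B"
  by transfer (rule blinfun_eqI)

instantiation bop :: (type) complex_vector
begin

lift_definition zero_bop :: "'a bop" is 0 by (simp add: zero_blinfun.rep_eq scaleR_eq_scaleC ell2_eqI)
lift_definition plus_bop :: "'a bop \<Rightarrow> 'a bop \<Rightarrow> 'a bop" is "(+)"
  by (simp add: plus_blinfun.rep_eq scaleC_add_right)
lift_definition uminus_bop :: "'a bop \<Rightarrow> 'a bop" is uminus
  by (auto simp: uminus_blinfun.rep_eq intro!: ell2_eqI)
lift_definition minus_bop :: "'a bop \<Rightarrow> 'a bop \<Rightarrow> 'a bop" is "(-)"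
  by (auto simp: minus_blinfun.rep_eq algebra_simps intro!: ell2_eqI)
lift_definition scaleR_bop :: "real \<Rightarrow> 'a bop \<Rightarrow> 'a bop" is "(*\<^sub>R)"
  by (auto simp: scaleR_blinfun.rep_eq algebra_simps intro!: ell2_eqI)

lemma bounded_linear_scaleC_ell2: "bounded_linear ((*\<^sub>C) c :: 'a ell2 \<Rightarrow> 'a ell2)"
  by (rule bounded_linear_intro[where K = "cmod c"])
    (auto simp: scaleC_add_right norm_scaleC_ell2 algebra_simps intro!: ell2_eqI)

lift_definition scaleC_bop :: "complex \<Rightarrow> 'a bop \<Rightarrow> 'a bop"
  is "\<lambda>c A. Blinfun ((*\<^sub>C) c) o\<^sub>L A"
  by (auto simp: bounded_linear_Blinfun_apply[OF bounded_linear_scaleC_ell2] algebra_simps intro!: ell2_eqI)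

lemma bop_apply_simps:
  fixes A B :: "'a bop"
  shows "bop_apply 0 x = 0"
  "bop_apply (A + B) x = bop_apply A x + bop_apply B x"
  "bop_apply (- A) x = - bop_apply A x"
  "bop_apply (A - B) x = bop_apply A x - bop_apply B x"
  "bop_apply (r *\<^sub>R A) x = r *\<^sub>R bop_apply A x"
  "bop_apply (c *\<^sub>C A) x = c *\<^sub>C bop_apply A x"
  by (transfer; simp add: plus_blinfun.rep_eq uminus_blinfun.rep_eq minus_blinfun.rep_eq
      scaleR_blinfun.rep_eq bounded_linear_Blinfun_apply[OF bounded_linear_scaleC_ell2])+

instance
  by standard (auto intro!: bop_eqI ell2_eqI simp: bop_apply_simps algebra_simps)

end

instantiation bop :: (type) real_normed_algebra_1
begin

lift_definition times_bop :: "'a bop \<Rightarrow> 'a bop \<Rightarrow> 'a bop" is "(o\<^sub>L)" by simp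
lift_definition one_bop :: "'a bop" is id_blinfun by simp
lift_definition norm_bop :: "'a bop \<Rightarrow> real" is norm .
definition sgn_bop :: "'a bop \<Rightarrow> 'a bop" where "sgn_bop x = inverse (norm x) *\<^sub>R x"
definition dist_bop :: "'a bop \<Rightarrow> 'a bop \<Rightarrow> real" where "dist_bop x y = norm (x - y)"
definition uniformity_bop :: "('a bop \<times> 'a bop) filter"
  where "uniformity_bop = (INF e\<in>{0<..}. principal {(x, y). dist x y < e})"
definition open_bop :: "'a bop set \<Rightarrow> bool"
  where "open_bop U = (\<forall>x\<in>U. eventually (\<lambda>(x', y). x' = x \<longrightarrow> y \<in> U) uniformity)"

lemma bop_apply_times: "bop_apply (A * B) x = bop_apply A (bop_apply B x)"
  by transfer simp

lemma bop_apply_one: "bop_apply 1 x = x"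
  by transfer simp

lemma bounded_linear_bop_apply: "bounded_linear (bop_apply A)"
  by transfer (rule blinfun.bounded_linear_right)

lemma bop_apply_add: "bop_apply A (x + y) = bop_apply A x + bop_apply A y"
  by (rule linear_add[OF bounded_linear.linear[OF bounded_linear_bop_apply]])

lemma bop_apply_diff: "bop_apply A (x - y) = bop_apply A x - bop_apply A y"
  by (rule linear_diff[OF bounded_linear.linear[OF bounded_linear_bop_apply]])

lemma bop_apply_scaleC: "bop_apply A (c *\<^sub>C x) = c *\<^sub>C bop_apply A x"
  by transfer simp

lemma bop_apply_scaleR: "bop_apply A (c *\<^sub>R x) = c *\<^sub>R bop_apply A x"
  by (simp add: scaleR_eq_scaleC bop_apply_scaleC)

lemma norm_bop_apply: "norm (bop_apply A x) \<le> norm A * norm x"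
  by transfer (rule norm_blinfun)

instance
proof
  fix x y z :: "'a bop" and r :: real and U :: "'a bop set"
  show "dist x y = norm (x - y)" by (rule dist_bop_def)
  show "sgn x = inverse (norm x) *\<^sub>R x" by (rule sgn_bop_def)
  show "uniformity = (INF e\<in>{0<..}. principal {(x, y::'a bop). dist x y < e})"
    by (rule uniformity_bop_def)
  show "open U = (\<forall>x\<in>U. eventually (\<lambda>(x', y). x' = x \<longrightarrow> y \<in> U) uniformity)"
    by (rule open_bop_def)
  show "norm x = 0 \<longleftrightarrow> x = 0" by transfer simp
  show "norm (x + y) \<le> norm x + norm y" by transfer (rule norm_triangle_ineq)
  show "norm (r *\<^sub>R x) = \<bar>r\<bar> * norm x" by transfer simp
  show "norm (x * y) \<le> norm x * norm y" by transfer (rule norm_blinfun_compose)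
  show "(x * y) * z = x * (y * z)" "1 * x = x" "x * 1 = x"
    by (auto intro!: bop_eqI simp: bop_apply_times bop_apply_one)
  show "(x + y) * z = x * z + y * z" "x * (y + z) = x * y + x * z"
    "(r *\<^sub>R x) * y = r *\<^sub>R (x * y)" "x * (r *\<^sub>R y) = r *\<^sub>R (x * y)"
    by (auto intro!: bop_eqI simp: bop_apply_times bop_apply_simps bop_apply_add bop_apply_scaleR)
  obtain a :: 'a where True by simp
  show "(0 :: 'a bop) \<noteq> 1"
  proof
    assume "(0 :: 'a bop) = 1"
    then have "bop_apply 0 (ket a) = bop_apply 1 (ket a)" by simp
    then show False using norm_ket[of a] by (simp add: bop_apply_simps bop_apply_one)
  qed
  have "norm (1 :: 'a bop) \<le> 1"
    by transfer (rule norm_blinfun_bound, auto)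
  moreover have "1 \<le> norm (1 :: 'a bop)"
    using norm_bop_apply[of 1 "ket a"] by (simp add: bop_apply_one norm_ket)
  ultimately show "norm (1 :: 'a bop) = 1" by simp
qed

end


subsection \<open>Density of the finitely supported vectors\<close>

interpretation cvec: vector_space "scaleC :: complex \<Rightarrow> 'a \<Rightarrow> 'a::complex_vector"
  by (rule vector_space_scaleC)

lemma ell2_nth_sum: "ell2_nth (\<Sum>i\<in>F. f i) j = (\<Sum>i\<in>F. ell2_nth (f i) j)"
  by (induction F rule: infinite_finite_induct) auto

lemma ell2_nth_sum_ket:
  "finite F \<Longrightarrow> ell2_nth (\<Sum>i\<in>F. c i *\<^sub>C ket i) j = (if j \<in> F then c j else 0)"
  by (simp add: ell2_nth_sum ell2_nth_ket if_distrib cong: if_cong)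

lemma norm_sum_ket_square:
  assumes "finite F"
  shows "(norm (\<Sum>i\<in>F. c i *\<^sub>C ket i))\<^sup>2 = (\<Sum>i\<in>F. (cmod (c i))\<^sup>2)"
proof -
  have "(norm (\<Sum>i\<in>F. c i *\<^sub>C ket i))\<^sup>2 = (\<Sum>\<^sub>\<infinity>i\<in>F. (cmod (c i))\<^sup>2)"
    unfolding norm_ell2_square
    by (rule infsum_cong_neutral) (auto simp: ell2_nth_sum_ket assms)
  with assms show ?thesis by simp
qed

lemma in_closure_cspan_ket:
  assumes "\<And>i. i \<notin> S \<Longrightarrow> ell2_nth x i = 0"
  shows "x \<in> closure (cspan (ket ` S))"
  unfolding closure_approachable
proof (intro allI impI)
  fix e :: real assume "e > 0"
  define f where "f = (\<lambda>i. (cmod (ell2_nth x i))\<^sup>2)"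
  have summ: "f summable_on A" for A unfolding f_def by (rule ell2_nth_summable)
  have "(norm x)\<^sup>2 = infsum f S"
    unfolding norm_ell2_square f_def by (rule infsum_cong_neutral) (auto simp: assms)
  obtain F where F: "finite F" "F \<subseteq> S" "dist (sum f F) (infsum f S) \<le> e\<^sup>2 / 2"
    using infsum_finite_approximation[OF summ[of S], of "e\<^sup>2 / 2"] \<open>e > 0\<close> by auto
  define y where "y = (\<Sum>i\<in>F. ell2_nth x i *\<^sub>C ket i)"
  have "(norm (y - x))\<^sup>2 = infsum f (S - F)"
    unfolding norm_ell2_square f_def
    by (rule infsum_cong_neutral) (auto simp: y_def ell2_nth_sum_ket F assms)
  also have "\<dots> = infsum f S - sum f F"
    using infsum_Diff[OF summ summ F(2)] F(1) by simp
  also have "\<dots> \<le> e\<^sup>2 / 2" using F(3) unfolding dist_real_def by linarith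
  also have "\<dots> < e\<^sup>2" using \<open>e > 0\<close> by simp
  finally have "norm (y - x) < e"
    using \<open>e > 0\<close> by (simp add: power_less_imp_less_base)
  moreover have "y \<in> cspan (ket ` S)"
    unfolding y_def cspan_def using F(2)
    by (intro cvec.span_sum cvec.span_scale cvec.span_base) auto
  ultimately show "\<exists>y\<in>cspan (ket ` S). dist y x < e"
    by (auto simp: dist_norm)
qed

lemma bounded_linear_cinner_left: "bounded_linear (\<lambda>x. cinner x y)"
  by (rule bounded_linear_intro[where K = "norm y"])
    (auto simp: cinner_add_left scaleR_eq_scaleC cinner_scaleC_left cmod_cinner_le scaleR_conv_of_real)

lemma bounded_linear_cinner_right: "bounded_linear (\<lambda>y. cinner x y)"
  by (rule bounded_linear_intro[where K = "norm x"])
    (auto simp: cinner_add_right scaleR_eq_scaleC cinner_scaleC_right scaleR_conv_of_real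
      order.trans[OF cmod_cinner_le] mult.commute)

lemma closure_cspan_ket_eq:
  "closure (cspan (ket ` S)) = {x. \<forall>i. i \<notin> S \<longrightarrow> ell2_nth x i = 0}" (is "?L = ?R")
proof (rule equalityI)
  have "?R = (\<Inter>i\<in>-S. {x. cinner (ket i) x = 0})"
    by (auto simp: cinner_ket)
  also have "closed \<dots>"
    by (intro closed_INT ballI closed_Collect_eq continuous_on_const
        linear_continuous_on bounded_linear_cinner_right)
  finally have "closed ?R" .
  moreover have "cspan (ket ` S) \<subseteq> ?R"
    unfolding cspan_def
    by (rule cvec.span_minimal) (auto simp: ell2_nth_ket cvec.subspace_def)
  ultimately show "?L \<subseteq> ?R" by (rule closure_minimal[rotated])
qed (auto intro: in_closure_cspan_ket)

lemma cinner_left_eqI: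
  assumes "bounded_linear f" "\<And>c z. f (c *\<^sub>C z) = cnj c * f z" "\<And>i. f (ket i) = cinner (ket i) y"
  shows "f x = cinner x y"
proof -
  let ?R = "{x. f x = cinner x y}"
  have "closed ?R"
    by (intro closed_Collect_eq linear_continuous_on bounded_linear_cinner_left assms(1))
  moreover have "cspan (range ket) \<subseteq> ?R"
    unfolding cspan_def
    by (rule cvec.span_minimal)
      (auto simp: assms cvec.subspace_def cinner_add_left cinner_scaleC_left
        linear_add[OF bounded_linear.linear[OF assms(1)]]
        linear_0[OF bounded_linear.linear[OF assms(1)]]
        linear_0[OF bounded_linear.linear[OF bounded_linear_cinner_left]])
  ultimately have "closure (cspan (range ket)) \<subseteq> ?R" by (rule closure_minimal[rotated])
  then show ?thesis by (auto simp: closure_cspan_ket_eq)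
qed

subsection \<open>Adjoints and projections\<close>

lemma Bop_exists:
  fixes f :: "'a ell2 \<Rightarrow> 'a ell2"
  assumes "\<And>x y. f (x + y) = f x + f y" "\<And>c x. f (c *\<^sub>C x) = c *\<^sub>C f x"
    and "\<And>x. norm (f x) \<le> K * norm x"
  shows "\<exists>A. bop_apply A = f"
proof -
  have bl: "bounded_linear f"
    by (rule bounded_linear_intro[where K = K])
      (simp_all add: assms scaleR_eq_scaleC mult.commute[of _ K])
  have "bop_apply (Bop (Blinfun f)) = f"
    by (simp add: bop_apply.rep_eq Bop_inverse bounded_linear_Blinfun_apply[OF bl] assms)
  then show ?thesis by blast
qed

text \<open>The adjoint always exists (see \<open>cinner_adj_left\<close> below), so the description is proper.\<close>

definition adj :: "'a bop \<Rightarrow> 'a bop"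
  where "adj A = (THE B. \<forall>x y. cinner (bop_apply B x) y = cinner x (bop_apply A y))"

lemma adj_exists: "\<exists>B. \<forall>x y. cinner (bop_apply B x) y = cinner x (bop_apply A y)"
proof -
  define b where "b y i = cinner (bop_apply A (ket i)) y" for y i
  have bound: "(\<Sum>i\<in>F. (cmod (b y i))\<^sup>2) \<le> (norm A * norm y)\<^sup>2" if F: "finite F" for y F
  proof -
    define z where "z = (\<Sum>i\<in>F. b y i *\<^sub>C ket i)"
    have "bop_apply A z = (\<Sum>i\<in>F. b y i *\<^sub>C bop_apply A (ket i))"
      unfolding z_def
      by (simp add: linear_sum[OF bounded_linear.linear[OF bounded_linear_bop_apply]]
          bop_apply_scaleC)
    then have "cinner (bop_apply A z) y = (\<Sum>i\<in>F. cnj (b y i) * b y i)"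
      by (simp add: linear_sum[OF bounded_linear.linear[OF bounded_linear_cinner_left]]
          cinner_scaleC_left b_def)
    also have "\<dots> = complex_of_real (\<Sum>i\<in>F. (cmod (b y i))\<^sup>2)"
      unfolding of_real_sum
      by (intro sum.cong refl) (simp only: complex_norm_square mult.commute)
    also have "\<dots> = complex_of_real ((norm z)\<^sup>2)"
      unfolding z_def norm_sum_ket_square[OF F] ..
    finally have "(norm z)\<^sup>2 = cmod (cinner (bop_apply A z) y)"
      by (simp only: norm_of_real abs_power2)
    also have "\<dots> \<le> norm (bop_apply A z) * norm y" by (rule cmod_cinner_le)
    also have "\<dots> \<le> norm A * norm z * norm y"
      by (intro mult_right_mono norm_bop_apply) simp
    finally have *: "norm z * norm z \<le> (norm A * norm y) * norm z"
      unfolding power2_eq_square by (simp only: mult_ac)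
    have "norm z \<le> norm A * norm y"
    proof (cases "norm z = 0")
      case False
      then show ?thesis by (intro mult_right_le_imp_le[OF *]) simp
    qed simp
    then have "(norm z)\<^sup>2 \<le> (norm A * norm y)\<^sup>2" by (rule power_mono) simp
    then show ?thesis unfolding z_def norm_sum_ket_square[OF F] .
  qed
  have summ: "(\<lambda>i. (cmod (b y i))\<^sup>2) summable_on UNIV" for y
  proof (rule nonneg_bounded_partial_sums_imp_summable_on)
    show "eventually (\<lambda>F. (\<Sum>i\<in>F. (cmod (b y i))\<^sup>2) \<le> (norm A * norm y)\<^sup>2)
        (finite_subsets_at_top UNIV)"
      by (rule eventually_finite_subsets_at_top_weakI) (rule bound)
  qed simp
  define f where "f y = Ell2 (b y)" for y
  have nth: "ell2_nth (f y) i = b y i" for y i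
    unfolding f_def using summ by (simp add: Ell2_inverse)
  have "\<exists>B. bop_apply B = f"
  proof (rule Bop_exists)
    show "f (x + y) = f x + f y" for x y
      by (rule ell2_eqI) (simp add: nth b_def cinner_add_right)
    show "f (c *\<^sub>C x) = c *\<^sub>C f x" for c x
      by (rule ell2_eqI) (simp add: nth b_def cinner_scaleC_right)
    show "norm (f x) \<le> norm A * norm x" for x
    proof -
      have "(norm (f x))\<^sup>2 \<le> (norm A * norm x)\<^sup>2"
        unfolding norm_ell2_square nth
        by (rule infsum_le_finite_sums[OF summ[of x]]) (rule bound)
      then show ?thesis by (rule power2_le_imp_le) simp
    qed
  qed
  then obtain B where B: "bop_apply B = f" ..
  have "cinner (bop_apply A y) x = cinner y (bop_apply B x)" for x y
  proof (rule cinner_left_eqI)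
    show "bounded_linear (\<lambda>y. cinner (bop_apply A y) x)"
      by (rule bounded_linear_compose[OF bounded_linear_cinner_left bounded_linear_bop_apply])
    show "cinner (bop_apply A (ket i)) x = cinner (ket i) (bop_apply B x)" for i
      by (simp add: B cinner_ket nth b_def)
  qed (simp add: bop_apply_scaleC cinner_scaleC_left)
  then have "cinner (bop_apply B x) y = cinner x (bop_apply A y)" for x y
    using cinner_commute[of "bop_apply B x" y] cinner_commute[of x "bop_apply A y"] by simp
  then show ?thesis by blast
qed

lemma adj_unique:
  assumes "\<And>x y. cinner (bop_apply B x) y = cinner x (bop_apply A y)"
  shows "adj A = B"
  unfolding adj_def
proof (rule the_equality)
  fix C assume C: "\<forall>x y. cinner (bop_apply C x) y = cinner x (bop_apply A y)"
  show "C = B"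
    by (intro bop_eqI cinner_eqI_left) (simp add: C assms)
qed (use assms in blast)

lemma cinner_adj_left: "cinner (bop_apply (adj A) x) y = cinner x (bop_apply A y)"
proof -
  obtain B where B: "\<And>x y. cinner (bop_apply B x) y = cinner x (bop_apply A y)"
    using adj_exists[of A] by blast
  show ?thesis unfolding adj_unique[OF B] by (rule B)
qed

lemma cinner_adj_right: "cinner x (bop_apply (adj A) y) = cinner (bop_apply A x) y"
  by (subst (1 2) cinner_commute) (simp add: cinner_adj_left)

lemma adj_times: "adj (A * B) = adj B * adj A"
  by (rule adj_unique) (simp add: bop_apply_times cinner_adj_left)

definition is_projection :: "'a bop \<Rightarrow> bool"
  where "is_projection P \<longleftrightarrow> P * P = P \<and> adj P = P"

text \<open>
  The orthogonal projection onto \<open>M\<close>; meaningful for closed complex subspaces \<open>M\<close>, and computed for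
  the closed span of a set of basis vectors in \<open>ell2_nth_proj_onto_ket\<close> below.
\<close>

definition proj_onto :: "'a ell2 set \<Rightarrow> 'a bop"
  where "proj_onto M = (THE P. is_projection P \<and> range (bop_apply P) = M)"

lemma proj_onto_eqI:
  assumes P: "is_projection P" "range (bop_apply P) = M"
  shows "proj_onto M = P"
  unfolding proj_onto_def
proof (rule the_equality)
  fix Q assume Q: "is_projection Q \<and> range (bop_apply Q) = M"
  have absorb: "A * B = B"
    if A: "is_projection A" "range (bop_apply A) = M" and B: "range (bop_apply B) = M" for A B :: "'a bop"
  proof (rule bop_eqI)
    fix x
    obtain y where y: "bop_apply B x = bop_apply A y" using A(2) B by (metis rangeE rangeI)
    then show "bop_apply (A * B) x = bop_apply B x"
      using A(1) by (metis is_projection_def bop_apply_times)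
  qed
  have "Q = adj (P * Q)" using absorb[of P Q] P Q by (simp add: is_projection_def)
  also have "\<dots> = Q * P" using P Q by (simp add: adj_times is_projection_def)
  also have "\<dots> = P" using absorb[of Q P] P Q by simp
  finally show "Q = P" .
qed (use P in blast)

subsection \<open>Operators permuting basis vectors\<close>

text \<open>
  The operator sending a basis vector \<open>ket a\<close> to \<open>ket b\<close> if \<open>\<phi> a = Some b\<close>, and to \<open>0\<close> if
  \<open>\<phi> a = None\<close>; it exists if \<open>\<phi>\<close> is injective on its domain (\<open>partial_map_op_ket\<close> below).
\<close>

definition partial_map_op :: "('a \<Rightarrow> 'a option) \<Rightarrow> 'a bop"
  where "partial_map_op \<phi> =
    (THE A. \<forall>a. bop_apply A (ket a) = (case \<phi> a of None \<Rightarrow> 0 | Some b \<Rightarrow> ket b))"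

definition partial_inj :: "('a \<Rightarrow> 'a option) \<Rightarrow> bool"
  where "partial_inj \<phi> \<longleftrightarrow> (\<forall>a a' b. \<phi> a = Some b \<longrightarrow> \<phi> a' = Some b \<longrightarrow> a = a')"

lemma bop_eqI_ket:
  assumes "\<And>i. bop_apply A (ket i) = bop_apply B (ket i)"
  shows "A = B"
proof -
  have "adj A = adj B"
    by (intro bop_eqI ell2_eqI) (simp flip: cinner_ket add: cinner_adj_right assms)
  then show ?thesis by (intro bop_eqI cinner_eqI) (simp flip: cinner_adj_left)
qed

lemma partial_map_op_props:
  assumes inj: "partial_inj \<phi>"
  shows partial_map_op_ket:
      "bop_apply (partial_map_op \<phi>) (ket a) = (case \<phi> a of None \<Rightarrow> 0 | Some b \<Rightarrow> ket b)"
    and partial_map_op_nth_Some: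
      "\<phi> a = Some b \<Longrightarrow> ell2_nth (bop_apply (partial_map_op \<phi>) x) b = ell2_nth x a"
    and partial_map_op_nth_None:
      "(\<And>a. \<phi> a \<noteq> Some b) \<Longrightarrow> ell2_nth (bop_apply (partial_map_op \<phi>) x) b = 0"
proof -
  define R where "R = {b. \<exists>a. \<phi> a = Some b}"
  define p where "p b = (THE a. \<phi> a = Some b)" for b
  have p: "p b = a" if "\<phi> a = Some b" for a b
    unfolding p_def using inj that by (auto simp: partial_inj_def)
  have "inj_on p R"
    by (rule inj_onI) (auto simp: R_def p)
  define g where "g x b = (if b \<in> R then ell2_nth x (p b) else 0)" for x b
  have sumR: "(\<lambda>b. (cmod (ell2_nth x (p b)))\<^sup>2) summable_on R" for x
    using summable_on_reindex[OF \<open>inj_on p R\<close>, of "\<lambda>i. (cmod (ell2_nth x i))\<^sup>2"]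
      ell2_nth_summable[of x] by (simp add: o_def)
  have summ: "(\<lambda>b. (cmod (g x b))\<^sup>2) summable_on UNIV" for x
    by (rule summable_on_cong_neutral[THEN iffD1, rotated -1, OF sumR]) (auto simp: g_def)
  define f where "f x = Ell2 (g x)" for x
  have nth: "ell2_nth (f x) b = g x b" for x b
    unfolding f_def using summ by (simp add: Ell2_inverse)
  have "\<exists>A. bop_apply A = f"
  proof (rule Bop_exists)
    show "f (x + y) = f x + f y" for x y
      by (rule ell2_eqI) (simp add: nth g_def)
    show "f (c *\<^sub>C x) = c *\<^sub>C f x" for c x
      by (rule ell2_eqI) (simp add: nth g_def)
    show "norm (f x) \<le> 1 * norm x" for x
    proof -
      have "(norm (f x))\<^sup>2 = (\<Sum>\<^sub>\<infinity>b\<in>R. (cmod (ell2_nth x (p b)))\<^sup>2)"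
        unfolding norm_ell2_square nth by (rule infsum_cong_neutral) (auto simp: g_def)
      also have "\<dots> = (\<Sum>\<^sub>\<infinity>i\<in>p ` R. (cmod (ell2_nth x i))\<^sup>2)"
        using infsum_reindex[OF \<open>inj_on p R\<close>, of "\<lambda>i. (cmod (ell2_nth x i))\<^sup>2"]
        by (simp add: o_def)
      also have "\<dots> \<le> (norm x)\<^sup>2"
        unfolding norm_ell2_square by (rule infsum_mono_neutral) (auto intro: ell2_nth_summable)
      finally show ?thesis unfolding mult_1 by (rule power2_le_imp_le) simp
    qed
  qed
  then obtain A where A: "bop_apply A = f" ..
  have ket: "bop_apply A (ket a) = (case \<phi> a of None \<Rightarrow> 0 | Some b \<Rightarrow> ket b)" for a
  proof (rule ell2_eqI)
    fix b
    show "ell2_nth (bop_apply A (ket a)) b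
        = ell2_nth (case \<phi> a of None \<Rightarrow> 0 | Some b \<Rightarrow> ket b) b"
      unfolding A nth g_def
      by (cases "\<phi> a") (auto simp: ell2_nth_ket R_def p split: if_splits)
  qed
  have eq: "partial_map_op \<phi> = A"
    unfolding partial_map_op_def
    by (rule the_equality) (auto simp: ket intro!: bop_eqI_ket)
  show "bop_apply (partial_map_op \<phi>) (ket a) = (case \<phi> a of None \<Rightarrow> 0 | Some b \<Rightarrow> ket b)"
    unfolding eq by (rule ket)
  show "ell2_nth (bop_apply (partial_map_op \<phi>) x) b = ell2_nth x a" if "\<phi> a = Some b"
    using that p[OF that] unfolding eq A nth g_def R_def by auto
  show "ell2_nth (bop_apply (partial_map_op \<phi>) x) b = 0" if "\<And>a. \<phi> a \<noteq> Some b"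
    using that unfolding eq A nth g_def R_def by auto
qed

lemma ell2_nth_proj_onto_ket:
  "ell2_nth (bop_apply (proj_onto (closure (cspan (ket ` S)))) x) i
    = (if i \<in> S then ell2_nth x i else 0)"
proof -
  define \<phi> where "\<phi> = (\<lambda>a. if a \<in> S then Some a else None)"
  define P where "P = partial_map_op \<phi>"
  have inj: "partial_inj \<phi>"
    by (auto simp: partial_inj_def \<phi>_def split: if_splits)
  have nth: "ell2_nth (bop_apply P x) i = (if i \<in> S then ell2_nth x i else 0)" for x i
    unfolding P_def
  proof (cases "i \<in> S")
    case True
    then show "ell2_nth (bop_apply (partial_map_op \<phi>) x) i = (if i \<in> S then ell2_nth x i else 0)"
      using partial_map_op_nth_Some[OF inj, of i i x] by (simp add: \<phi>_def)
  next
    case False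
    then have "\<phi> a \<noteq> Some i" for a by (auto simp: \<phi>_def)
    with False show "ell2_nth (bop_apply (partial_map_op \<phi>) x) i
        = (if i \<in> S then ell2_nth x i else 0)"
      using partial_map_op_nth_None[OF inj, of i x] by simp
  qed
  have "proj_onto (closure (cspan (ket ` S))) = P"
  proof (rule proj_onto_eqI)
    have "P * P = P"
      by (intro bop_eqI ell2_eqI) (simp add: bop_apply_times nth)
    moreover have "adj P = P"
      by (rule adj_unique) (auto simp: cinner.rep_eq nth intro!: infsum_cong)
    ultimately show "is_projection P" by (simp add: is_projection_def)
    have "x = bop_apply P x" if "\<forall>i. i \<notin> S \<longrightarrow> ell2_nth x i = 0" for x
      using that by (intro ell2_eqI) (simp add: nth)
    then show "range (bop_apply P) = closure (cspan (ket ` S))"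
      by (auto simp: closure_cspan_ket_eq nth)
  qed
  then show ?thesis by (simp add: nth)
qed

section \<open>The path model of the AF algebra\<close>

definition vertices :: "(int \<times> int) set"
  where "vertices = insert (-1, 0) {(n, k). 0 \<le> n \<and> 0 \<le> k \<and> k \<le> 2 ^ nat n}"

definition edge :: "int \<times> int \<Rightarrow> int \<times> int \<Rightarrow> bool"
  where "edge = (\<lambda>(n, k) (n', l). (n, k) \<in> vertices \<and> (n', l) \<in> vertices \<and> n' = n + 1 \<and>
    (n = -1 \<or> \<bar>2 * k - l\<bar> \<le> 1))"

text \<open>Paths are indexed by the floors from \<open>-1\<close> on; the values below floor \<open>-1\<close> are dummies.\<close>

typedef path = "{\<xi> :: int \<Rightarrow> int. (\<forall>n\<le>-1. \<xi> n = 0) \<and> (\<forall>n\<ge>-1. edge (n, \<xi> n) (n + 1, \<xi> (n + 1)))}"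
  morphisms coord Path
  by (rule exI[of _ "\<lambda>_. 0"]) (auto simp: edge_def vertices_def)

text \<open>
  A finite path to floor \<open>r\<close> is represented by a coordinate function that vanishes above floor \<open>r\<close>.
\<close>

definition fin_paths :: "nat \<Rightarrow> (int \<Rightarrow> int) set"
  where "fin_paths r = {\<xi>. (\<forall>n. n \<le> -1 \<or> n > int r \<longrightarrow> \<xi> n = 0) \<and>
    (\<forall>n. -1 \<le> n \<and> n < int r \<longrightarrow> edge (n, \<xi> n) (n + 1, \<xi> (n + 1)))}"

definition truncate :: "nat \<Rightarrow> path \<Rightarrow> int \<Rightarrow> int"
  where "truncate r \<omega> = (\<lambda>n. if n \<le> int r then coord \<omega> n else 0)"

definition replace_start :: "nat \<Rightarrow> (int \<Rightarrow> int) \<Rightarrow> path \<Rightarrow> path"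
  where "replace_start r \<xi> \<omega> = Path (\<lambda>n. if n \<le> int r then \<xi> n else coord \<omega> n)"

definition matrix_unit :: "nat \<Rightarrow> (int \<Rightarrow> int) \<Rightarrow> (int \<Rightarrow> int) \<Rightarrow> path bop"
  where "matrix_unit r \<xi> \<eta> =
    partial_map_op (\<lambda>\<omega>. if truncate r \<omega> = \<eta> then Some (replace_start r \<xi> \<omega>) else None)"

definition finite_alg :: "nat \<Rightarrow> path bop set"
  where "finite_alg r =
    cspan {matrix_unit r \<xi> \<eta> | \<xi> \<eta>. \<xi> \<in> fin_paths r \<and> \<eta> \<in> fin_paths r \<and> \<xi> (int r) = \<eta> (int r)}"

definition AF_alg :: "path bop set"
  where "AF_alg = closure (\<Union>r. finite_alg r)"

text \<open>
  A path \<open>\<omega>\<close> with \<open>coord \<omega> (n - 1) = i\<close> takes an edge of type SW, S or SE to floor \<open>n\<close> if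
  \<open>coord \<omega> n\<close> is \<open>2 * i - 1\<close>, \<open>2 * i\<close> or \<open>2 * i + 1\<close>, respectively. For \<open>n = 0\<close> no path has an edge
  of type SW, so that \<open>e_op 0 = 0\<close>. Likewise \<open>w_op 0 = 0\<close> is a dummy.
\<close>

definition e_op :: "nat \<Rightarrow> path bop"
  where "e_op n = proj_onto (closure (cspan
    (ket ` {\<omega>. coord \<omega> (int n) = 2 * coord \<omega> (int n - 1) - 1})))"

definition f_op :: "nat \<Rightarrow> path bop"
  where "f_op n = proj_onto (closure (cspan
    (ket ` {\<omega>. coord \<omega> (int n) = 2 * coord \<omega> (int n - 1) + 1})))"

definition g_op :: "nat \<Rightarrow> path bop"
  where "g_op n = 1 - e_op n - f_op n"

definition set_coord :: "path \<Rightarrow> nat \<Rightarrow> int \<Rightarrow> path"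
  where "set_coord \<omega> n k = Path ((coord \<omega>)(int n := k))"

definition v_op :: "nat \<Rightarrow> path bop"
  where "v_op n = partial_map_op (\<lambda>\<omega>. let i = coord \<omega> (int n - 1) in
    if coord \<omega> (int n) = 2 * i \<and> coord \<omega> (int n + 1) = 4 * i + 1
    then Some (set_coord \<omega> n (2 * i + 1)) else None)"

definition w_op :: "nat \<Rightarrow> path bop"
  where "w_op n = partial_map_op (\<lambda>\<omega>. let i = coord \<omega> (int n - 1) in
    if coord \<omega> (int n) = 2 * i \<and> coord \<omega> (int n + 1) = 4 * i - 1
    then Some (set_coord \<omega> n (2 * i - 1)) else None)"

definition E_op :: "real \<Rightarrow> nat \<Rightarrow> path bop"
  where "E_op lam n = (1 / (1 + lam)) *\<^sub>R (adj (v_op n) * v_op n + sqrt lam *\<^sub>R v_op n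
    + sqrt lam *\<^sub>R adj (v_op n) + lam *\<^sub>R (v_op n * adj (v_op n)))"

definition F_op :: "real \<Rightarrow> nat \<Rightarrow> path bop"
  where "F_op lam n = (1 / (1 + lam)) *\<^sub>R (adj (w_op n) * w_op n + sqrt lam *\<^sub>R w_op n
    + sqrt lam *\<^sub>R adj (w_op n) + lam *\<^sub>R (w_op n * adj (w_op n)))"

definition commutator :: "'a::ring \<Rightarrow> 'a \<Rightarrow> 'a"
  where "commutator a b = a * b - b * a"

text \<open>
  The modified coordinate sequences occurring above are again paths, and the maps are injective,
  so that the operators act on the basis vectors as intended.
\<close>

lemma coord_le_m1: "n \<le> -1 \<Longrightarrow> coord \<omega> n = 0"
  using coord[of \<omega>] by blast

lemma coord_edge: "n \<ge> -1 \<Longrightarrow> edge (n, coord \<omega> n) (n + 1, coord \<omega> (n + 1))"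
  using coord[of \<omega>] by blast

lemma coord_vertex: "n \<ge> -1 \<Longrightarrow> (n, coord \<omega> n) \<in> vertices"
  using coord_edge[of n \<omega>] by (auto simp: edge_def)

lemma coord_eqI: "(\<And>n. coord \<omega> n = coord \<omega>' n) \<Longrightarrow> \<omega> = \<omega>'"
  using coord_inject[of \<omega> \<omega>'] by (simp add: fun_eq_iff)

lemma coord_replace_start:
  assumes "\<xi> \<in> fin_paths r" "\<xi> (int r) = coord \<omega> (int r)"
  shows "coord (replace_start r \<xi> \<omega>) n = (if n \<le> int r then \<xi> n else coord \<omega> n)"
proof -
  let ?\<zeta> = "\<lambda>n. if n \<le> int r then \<xi> n else coord \<omega> n"
  have "edge (m, ?\<zeta> m) (m + 1, ?\<zeta> (m + 1))" if "m \<ge> -1" for m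
  proof -
    consider "m < int r" | "m = int r" | "m > int r" by linarith
    then show ?thesis
      using that assms coord_edge[of m \<omega>] by cases (auto simp: fin_paths_def)
  qed
  then have "?\<zeta> \<in> {\<xi>. (\<forall>n\<le>-1. \<xi> n = 0) \<and> (\<forall>n\<ge>-1. edge (n, \<xi> n) (n + 1, \<xi> (n + 1)))}"
    using assms(1) by (auto simp: fin_paths_def)
  then show ?thesis by (simp add: replace_start_def Path_inverse)
qed

lemma matrix_unit_ket:
  assumes "\<xi> \<in> fin_paths r" "\<xi> (int r) = \<eta> (int r)"
  shows "bop_apply (matrix_unit r \<xi> \<eta>) (ket \<omega>)
    = (if truncate r \<omega> = \<eta> then ket (replace_start r \<xi> \<omega>) else 0)"
proof -
  have end_eq: "\<xi> (int r) = coord \<omega> (int r)" if "truncate r \<omega> = \<eta>" for \<omega>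
    using assms(2) that by (auto simp: truncate_def)
  have "partial_inj (\<lambda>\<omega>. if truncate r \<omega> = \<eta> then Some (replace_start r \<xi> \<omega>) else None)"
    unfolding partial_inj_def
  proof (intro allI impI)
    fix \<omega> \<omega>' \<omega>''
    assume "(if truncate r \<omega> = \<eta> then Some (replace_start r \<xi> \<omega>) else None) = Some \<omega>''"
      "(if truncate r \<omega>' = \<eta> then Some (replace_start r \<xi> \<omega>') else None) = Some \<omega>''"
    then have *: "truncate r \<omega> = \<eta>" "truncate r \<omega>' = \<eta>"
      "replace_start r \<xi> \<omega> = replace_start r \<xi> \<omega>'" by (auto split: if_splits)
    show "\<omega> = \<omega>'"
    proof (rule coord_eqI)
      fix n show "coord \<omega> n = coord \<omega>' n"
      proof (cases "n \<le> int r")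
        case True
        have "truncate r \<omega> n = truncate r \<omega>' n" using *(1,2) by simp
        with True show ?thesis by (simp add: truncate_def)
      next
        case False
        then show ?thesis
          using arg_cong[OF *(3), of "\<lambda>\<omega>. coord \<omega> n"]
          by (simp add: coord_replace_start[OF assms(1) end_eq[OF *(1)]]
              coord_replace_start[OF assms(1) end_eq[OF *(2)]])
      qed
    qed
  qed
  then show ?thesis by (simp add: matrix_unit_def partial_map_op_ket)
qed

lemma coord_set_coord:
  assumes "edge (int n - 1, coord \<omega> (int n - 1)) (int n, k)"
    and "edge (int n, k) (int n + 1, coord \<omega> (int n + 1))"
  shows "coord (set_coord \<omega> n k) m = (if m = int n then k else coord \<omega> m)"
proof -
  let ?\<zeta> = "(coord \<omega>)(int n := k)"
  have "edge (m, ?\<zeta> m) (m + 1, ?\<zeta> (m + 1))" if "m \<ge> -1" for m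
  proof -
    consider "m = int n" | "m + 1 = int n" | "m \<noteq> int n" "m + 1 \<noteq> int n" by linarith
    then show ?thesis
    proof cases
      case 2
      then have "m = int n - 1" by simp
      with assms(1) show ?thesis by simp
    qed (use assms that coord_edge[of m \<omega>] in simp_all)
  qed
  then have "?\<zeta> \<in> {\<xi>. (\<forall>n\<le>-1. \<xi> n = 0) \<and> (\<forall>n\<ge>-1. edge (n, \<xi> n) (n + 1, \<xi> (n + 1)))}"
    by (auto simp: coord_le_m1)
  then show ?thesis by (simp add: set_coord_def Path_inverse)
qed

lemma set_coord_cancel:
  assumes "\<And>m. coord (set_coord \<omega> n k) m = (if m = int n then k else coord \<omega> m)"
    and "\<And>m. coord (set_coord \<omega>' n k') m = (if m = int n then k' else coord \<omega>' m)"
    and "set_coord \<omega> n k = set_coord \<omega>' n k'" "m \<noteq> int n"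
  shows "coord \<omega> m = coord \<omega>' m"
  using assms(1)[of m] assms(2)[of m] assms(3,4) by simp

lemma coord_flip:
  fixes \<omega> n
  defines "i \<equiv> coord \<omega> (int n - 1)"
  assumes "coord \<omega> (int n) = 2 * i" "s = 1 \<or> s = -1" "coord \<omega> (int n + 1) = 4 * i + s"
  shows "coord (set_coord \<omega> n (2 * i + s)) m = (if m = int n then 2 * i + s else coord \<omega> m)"
proof (rule coord_set_coord)
  have V: "(int n - 1, i) \<in> vertices" "(int n, 2 * i) \<in> vertices"
    "(int n + 1, 4 * i + s) \<in> vertices"
    using coord_vertex[of "int n - 1" \<omega>] coord_vertex[of "int n" \<omega>] coord_vertex[of "int n + 1" \<omega>]
    by (simp_all add: assms)
  have "2 * i + s \<le> 2 ^ n \<and> 0 \<le> 2 * i + s"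
  proof (cases n)
    case 0
    then have "i = 0" using coord_le_m1[of "-1" \<omega>] by (simp add: i_def)
    with V(3) assms(3) 0 show ?thesis by (auto simp: vertices_def)
  next
    case (Suc k)
    have "nat (int n + 1) = Suc (Suc k)" using Suc by simp
    then have b: "4 * i + s \<le> 4 * 2 ^ k" "0 \<le> 4 * i + s" using V(3) by (auto simp: vertices_def)
    define p :: int where "p = 2 ^ k"
    have "4 * i + s \<le> 4 * p" "0 \<le> 4 * i + s" using b by (simp_all add: p_def)
    with assms(3) have "2 * i + s \<le> 2 * p \<and> 0 \<le> 2 * i + s" by (elim disjE) simp_all
    then show ?thesis by (simp add: p_def Suc)
  qed
  then have W: "(int n, 2 * i + s) \<in> vertices" by (auto simp: vertices_def)
  show "edge (int n - 1, coord \<omega> (int n - 1)) (int n, 2 * i + s)"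
    using V W assms(3) by (auto simp: edge_def i_def)
  show "edge (int n, 2 * i + s) (int n + 1, coord \<omega> (int n + 1))"
    using V W assms(3,4) by (auto simp: edge_def)
qed

lemma partial_inj_flip:
  assumes s: "s = 1 \<or> s = -1"
  shows "partial_inj (\<lambda>\<omega>. let i = coord \<omega> (int n - 1) in
    if coord \<omega> (int n) = 2 * i \<and> coord \<omega> (int n + 1) = 4 * i + s
    then Some (set_coord \<omega> n (2 * i + s)) else None)"
  unfolding partial_inj_def Let_def
proof (intro allI impI)
  fix \<omega> \<omega>' \<omega>''
  let ?i = "\<lambda>\<omega>. coord \<omega> (int n - 1)"
  assume "(if coord \<omega> (int n) = 2 * ?i \<omega> \<and> coord \<omega> (int n + 1) = 4 * ?i \<omega> + s
      then Some (set_coord \<omega> n (2 * ?i \<omega> + s)) else None) = Some \<omega>''"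
    "(if coord \<omega>' (int n) = 2 * ?i \<omega>' \<and> coord \<omega>' (int n + 1) = 4 * ?i \<omega>' + s
      then Some (set_coord \<omega>' n (2 * ?i \<omega>' + s)) else None) = Some \<omega>''"
  then have *: "coord \<omega> (int n) = 2 * ?i \<omega>" "coord \<omega> (int n + 1) = 4 * ?i \<omega> + s"
    "coord \<omega>' (int n) = 2 * ?i \<omega>'" "coord \<omega>' (int n + 1) = 4 * ?i \<omega>' + s"
    "set_coord \<omega> n (2 * ?i \<omega> + s) = set_coord \<omega>' n (2 * ?i \<omega>' + s)"
    by (auto split: if_splits)
  have eq: "coord \<omega> m = coord \<omega>' m" if "m \<noteq> int n" for m
    by (rule set_coord_cancel[OF coord_flip[OF *(1) s *(2)] coord_flip[OF *(3) s *(4)] *(5) that])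
  show "\<omega> = \<omega>'"
  proof (rule coord_eqI)
    show "coord \<omega> m = coord \<omega>' m" for m
      using eq[of m] eq[of "int n - 1"] *(1,3) by (cases "m = int n") simp_all
  qed
qed

lemma v_op_ket:
  "bop_apply (v_op n) (ket \<omega>) =
    (let i = coord \<omega> (int n - 1) in
     if coord \<omega> (int n) = 2 * i \<and> coord \<omega> (int n + 1) = 4 * i + 1
     then ket (set_coord \<omega> n (2 * i + 1)) else 0)"
  using partial_inj_flip[of 1 n] by (simp add: v_op_def partial_map_op_ket Let_def)

lemma w_op_ket:
  "bop_apply (w_op n) (ket \<omega>) =
    (let i = coord \<omega> (int n - 1) in
     if coord \<omega> (int n) = 2 * i \<and> coord \<omega> (int n + 1) = 4 * i - 1
     then ket (set_coord \<omega> n (2 * i - 1)) else 0)"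
  using partial_inj_flip[of "-1" n]
  by (simp add: w_op_def partial_map_op_ket Let_def cong: if_cong)

end

(*
Encode a path by its steps, the differences coord n - 2 * coord (n - 1), which are -1, 0, 1 for the edge
types SW, S, SE. For a sign s, flipping at floor n exchanges the pairs (0, s) and (s, -s) of steps at the
floors n, n + 1 and changes nothing else; s = 1 gives v_n and E_n, and s = -1 gives w_n and F_n. Thus
E_n and F_n are orthogonal sums of rank-one projections onto the lines spanned by
(0, s) + sqrt(lam) (s, -s), and the relations follow by evaluating both sides on each basis vector: flips at
floors at distance at least two do not interact, and everything else is a finite case distinction on three
consecutive steps.
*)
theory Submission
  imports Defs
begin

section \<open>Steps of a path and flips at one floor\<close>

definition step :: "path \<Rightarrow> nat \<Rightarrow> int"
  where "step \<omega> n = coord \<omega> (int n) - 2 * coord \<omega> (int n - 1)"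

text \<open>One map serves both directions of the flip. It is meant for paths in
  \<open>flip_upper\<close> or \<open>flip_lower\<close>; elsewhere the altered sequence need not be
  a path and the value is a dummy.\<close>

definition flip :: "int \<Rightarrow> nat \<Rightarrow> path \<Rightarrow> path"
  where "flip s n \<omega> = set_coord \<omega> n (coord \<omega> (int n) + (if step \<omega> n = 0 then s else - s))"

text \<open>The basis paths of the initial space of the partial isometry, those of the final space
  being \<open>flip_lower\<close>. For s = 1 they belong to g_n f_{n+1} and f_n e_{n+1}, for s = -1
  to g_n e_{n+1} and e_n f_{n+1}.\<close>

definition flip_upper :: "int \<Rightarrow> nat \<Rightarrow> path \<Rightarrow> bool"
  where "flip_upper s n \<omega> \<longleftrightarrow> step \<omega> n = 0 \<and> step \<omega> (Suc n) = s"

definition flip_lower :: "int \<Rightarrow> nat \<Rightarrow> path \<Rightarrow> bool"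
  where "flip_lower s n \<omega> \<longleftrightarrow> step \<omega> n = s \<and> step \<omega> (Suc n) = - s"

lemma step_Suc: "step \<omega> (Suc n) = coord \<omega> (int n + 1) - 2 * coord \<omega> (int n)"
  by (simp add: step_def add.commute)

lemma coord_flip_upper:
  assumes s: "s = 1 \<or> s = -1" and w: "flip_upper s n \<omega>"
  shows "coord (flip s n \<omega>) m = coord \<omega> m + (if m = int n then s else 0)"
  using coord_flip[OF _ s, of \<omega> n m] w
  by (simp add: flip_def flip_upper_def step_def[of _ n] step_Suc)

lemma coord_flip_lower:
  assumes s: "s = 1 \<or> s = -1" and w: "flip_lower s n \<omega>"
  shows "coord (flip s n \<omega>) m = coord \<omega> m - (if m = int n then s else 0)"
proof -
  let ?i = "coord \<omega> (int n - 1)"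
  have c: "coord \<omega> (int n) = 2 * ?i + s" "coord \<omega> (int n + 1) = 4 * ?i + s"
    using w by (simp_all add: flip_lower_def step_def[of _ n] step_Suc)
  have V: "(int n - 1, ?i) \<in> vertices" "(int n + 1, 4 * ?i + s) \<in> vertices"
    using coord_vertex[of "int n - 1" \<omega>] coord_vertex[of "int n + 1" \<omega>] c by simp_all
  \<comment> \<open>Flipping back leads to an S edge, whose endpoint always exists: doubling keeps
    the bounds of the previous floor, and on floor 0 the predecessor has coordinate 0.\<close>
  have "(int n, 2 * ?i) \<in> vertices"
  proof (cases n)
    case (Suc k)
    then have "(int n, 2 * ?i) \<in> vertices \<longleftrightarrow> 0 \<le> ?i \<and> ?i \<le> 2 ^ k"
      by (simp add: vertices_def nat_add_distrib)
    with V(1) Suc show ?thesis by (auto simp: vertices_def)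
  qed (use V(1) in \<open>auto simp: vertices_def\<close>)
  then have "coord (set_coord \<omega> n (2 * ?i)) m = (if m = int n then 2 * ?i else coord \<omega> m)"
    using V s c by (intro coord_set_coord) (auto simp: edge_def)
  then show ?thesis
    using w s by (auto simp: flip_def flip_lower_def c)
qed

lemma step_flip_upper:
  assumes "s = 1 \<or> s = -1" "flip_upper s n \<omega>"
  shows "step (flip s n \<omega>) m = (if m = n then s else if m = Suc n then - s else step \<omega> m)"
  using assms(2) by (auto simp: step_def coord_flip_upper[OF assms] flip_upper_def)

lemma step_flip_lower:
  assumes "s = 1 \<or> s = -1" "flip_lower s n \<omega>"
  shows "step (flip s n \<omega>) m = (if m = n then 0 else if m = Suc n then s else step \<omega> m)"
  using assms(2) by (auto simp: step_def coord_flip_lower[OF assms] flip_lower_def)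

lemma flip_lower_flip:
  assumes "s = 1 \<or> s = -1" "flip_upper s n \<omega>"
  shows "flip_lower s n (flip s n \<omega>)"
  by (simp add: flip_lower_def step_flip_upper[OF assms])

lemma flip_upper_flip:
  assumes "s = 1 \<or> s = -1" "flip_lower s n \<omega>"
  shows "flip_upper s n (flip s n \<omega>)"
  by (simp add: flip_upper_def step_flip_lower[OF assms])

text \<open>The flip exchanges the two sets, and \<open>s\<close> is added to coordinate
  \<open>n\<close> on the way out and subtracted on the way back.\<close>

lemma flip_flip:
  assumes s: "s = 1 \<or> s = -1" and w: "flip_upper s n \<omega> \<or> flip_lower s n \<omega>"
  shows "flip s n (flip s n \<omega>) = \<omega>"
  using w
proof
  assume "flip_upper s n \<omega>"
  then show ?thesis
    by (intro coord_eqI) (simp add: coord_flip_lower[OF s flip_lower_flip[OF s]] coord_flip_upper[OF s])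
next
  assume "flip_lower s n \<omega>"
  then show ?thesis
    by (intro coord_eqI) (simp add: coord_flip_upper[OF s flip_upper_flip[OF s]] coord_flip_lower[OF s])
qed

section \<open>The partial isometries and their projections, with the sign as a parameter\<close>

definition flip_op :: "int \<Rightarrow> nat \<Rightarrow> path bop"
  where "flip_op s n = partial_map_op (\<lambda>\<omega>. let i = coord \<omega> (int n - 1) in
    if coord \<omega> (int n) = 2 * i \<and> coord \<omega> (int n + 1) = 4 * i + s
    then Some (set_coord \<omega> n (2 * i + s)) else None)"

definition flip_proj :: "real \<Rightarrow> int \<Rightarrow> nat \<Rightarrow> path bop"
  where "flip_proj lam s n = (1 / (1 + lam)) *\<^sub>R (adj (flip_op s n) * flip_op s n
    + sqrt lam *\<^sub>R flip_op s n + sqrt lam *\<^sub>R adj (flip_op s n)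
    + lam *\<^sub>R (flip_op s n * adj (flip_op s n)))"

lemma E_op_eq_flip_proj: "E_op lam = flip_proj lam 1"
  by (simp add: fun_eq_iff E_op_def flip_proj_def v_op_def flip_op_def)

lemma F_op_eq_flip_proj: "F_op lam = flip_proj lam (-1)"
  by (simp add: fun_eq_iff F_op_def flip_proj_def w_op_def flip_op_def cong: if_cong)

lemma flip_op_ket:
  assumes s: "s = 1 \<or> s = -1"
  shows "bop_apply (flip_op s n) (ket \<omega>) = (if flip_upper s n \<omega> then ket (flip s n \<omega>) else 0)"
  unfolding flip_op_def partial_map_op_ket[OF partial_inj_flip[OF s]]
  by (auto simp: Let_def flip_upper_def flip_def step_def[of _ n] step_Suc algebra_simps)

lemma cinner_ket_ket: "cinner (ket a) (ket b) = (if a = b then 1 else 0)"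
  by (simp add: cinner_ket ell2_nth_ket)

lemma adj_flip_op_ket:
  assumes s: "s = 1 \<or> s = -1"
  shows "bop_apply (adj (flip_op s n)) (ket \<omega>) = (if flip_lower s n \<omega> then ket (flip s n \<omega>) else 0)"
proof (rule ell2_eqI)
  fix \<xi>
  have "ell2_nth (bop_apply (adj (flip_op s n)) (ket \<omega>)) \<xi> =
      (if flip_upper s n \<xi> \<and> flip s n \<xi> = \<omega> then 1 else 0)"
    by (simp flip: cinner_ket add: cinner_adj_right flip_op_ket[OF s] cinner_ket_ket)
      (simp add: cinner.rep_eq)
  \<comment> \<open>The flip is its own inverse between the two sets, so the position of the only
    nonzero matrix entry can be read off from \<open>\<omega>\<close>.\<close>
  also have "flip_upper s n \<xi> \<and> flip s n \<xi> = \<omega> \<longleftrightarrow> flip_lower s n \<omega> \<and> flip s n \<omega> = \<xi>"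
    using flip_flip[OF s] flip_upper_flip[OF s] flip_lower_flip[OF s] by blast
  finally show "ell2_nth (bop_apply (adj (flip_op s n)) (ket \<omega>)) \<xi> =
      ell2_nth (if flip_lower s n \<omega> then ket (flip s n \<omega>) else 0) \<xi>"
    by (auto simp: ell2_nth_ket)
qed

lemma bop_apply_0_right: "bop_apply A 0 = 0"
  by (rule linear_0[OF bounded_linear.linear[OF bounded_linear_bop_apply]])

text \<open>On the span of a path in \<open>flip_upper\<close> and its flip, the operator is the
  symmetric 2 by 2 matrix with diagonal 1, \<open>lam\<close> and off-diagonal
  \<open>sqrt lam\<close>, divided by \<open>1 + lam\<close>. The algebraic relations are all
  computed from this formula.\<close>

lemma flip_proj_ket:
  assumes s: "s = 1 \<or> s = -1"
  shows "bop_apply (flip_proj lam s n) (ket \<omega>) =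
    (if flip_upper s n \<omega>
       then (1 / (1 + lam)) *\<^sub>R ket \<omega> + (sqrt lam / (1 + lam)) *\<^sub>R ket (flip s n \<omega>)
     else if flip_lower s n \<omega>
       then (lam / (1 + lam)) *\<^sub>R ket \<omega> + (sqrt lam / (1 + lam)) *\<^sub>R ket (flip s n \<omega>)
     else 0)"
proof -
  \<comment> \<open>Step \<open>n\<close> is 0 in one case and \<open>s\<close> in the other, so the
    order of the two tests is immaterial.\<close>
  have "flip_upper s n \<omega> \<Longrightarrow> \<not> flip_lower s n \<omega>"
    using s by (auto simp: flip_upper_def flip_lower_def)
  then show ?thesis
    by (auto simp: flip_proj_def bop_apply_simps bop_apply_times flip_op_ket[OF s]
      adj_flip_op_ket[OF s] flip_lower_flip[OF s] flip_upper_flip[OF s] flip_flip[OF s] scaleR_add_right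
      bop_apply_0_right)
qed

lemma adj_adj: "adj (adj A) = A"
  by (rule adj_unique) (simp add: cinner_adj_right)

lemma adj_add: "adj (A + B) = adj A + adj B"
  by (rule adj_unique)
    (simp add: bop_apply_simps cinner_add_left cinner_add_right cinner_adj_left)

lemma adj_scaleR: "adj (r *\<^sub>R A) = r *\<^sub>R adj A"
  by (rule adj_unique)
    (simp add: bop_apply_simps cinner_scaleC_left cinner_scaleC_right scaleR_eq_scaleC cinner_adj_left)

lemma adj_flip_proj: "adj (flip_proj lam s n) = flip_proj lam s n"
  by (simp add: flip_proj_def adj_scaleR adj_add adj_times adj_adj add_ac)

section \<open>The projections onto the paths with a given step\<close>

definition step_proj :: "nat \<Rightarrow> int \<Rightarrow> path bop"
  where "step_proj n k = proj_onto (closure (cspan (ket ` {\<omega>. step \<omega> n = k})))"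

lemma step_proj_ket: "bop_apply (step_proj n k) (ket \<omega>) = (if step \<omega> n = k then ket \<omega> else 0)"
  by (rule ell2_eqI) (auto simp: step_proj_def ell2_nth_proj_onto_ket ell2_nth_ket)

text \<open>At floor 0 the predecessor has coordinate 0, so the step is the coordinate itself, 0 or
  1; at later floors this is the edge condition. The trichotomy makes the case distinctions below
  finite.\<close>

lemma step_cases: "step \<omega> n = -1 \<or> step \<omega> n = 0 \<or> step \<omega> n = 1"
proof (cases n)
  case 0
  then show ?thesis
    using coord_vertex[of 0 \<omega>] coord_le_m1[of "-1" \<omega>] by (auto simp: step_def vertices_def)
next
  case (Suc k)
  then show ?thesis
    using coord_edge[of "int k" \<omega>] by (auto simp: step_def edge_def add.commute)
qed

lemma e_op_eq: "e_op n = step_proj n (-1)"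
proof -
  have "{\<omega>. coord \<omega> (int n) = 2 * coord \<omega> (int n - 1) - 1} = {\<omega>. step \<omega> n = -1}"
    by (auto simp: step_def)
  then show ?thesis by (simp add: e_op_def step_proj_def)
qed

lemma f_op_eq: "f_op n = step_proj n 1"
proof -
  have "{\<omega>. coord \<omega> (int n) = 2 * coord \<omega> (int n - 1) + 1} = {\<omega>. step \<omega> n = 1}"
    by (auto simp: step_def)
  then show ?thesis by (simp add: f_op_def step_proj_def)
qed

lemma g_op_eq: "g_op n = step_proj n 0"
proof (rule bop_eqI_ket)
  show "bop_apply (g_op n) (ket \<omega>) = bop_apply (step_proj n 0) (ket \<omega>)" for \<omega>
    using step_cases[of \<omega> n]
    by (auto simp: g_op_def e_op_eq f_op_eq bop_apply_simps bop_apply_one step_proj_ket)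
qed

section \<open>Evaluation of products on basis vectors\<close>

lemma step_flip:
  assumes s: "s = 1 \<or> s = -1"
  shows "step \<omega> n = 0 \<Longrightarrow> step \<omega> (Suc n) = s \<Longrightarrow>
      step (flip s n \<omega>) m = (if m = n then s else if m = Suc n then - s else step \<omega> m)"
    and "step \<omega> n = s \<Longrightarrow> step \<omega> (Suc n) = - s \<Longrightarrow>
      step (flip s n \<omega>) m = (if m = n then 0 else if m = Suc n then s else step \<omega> m)"
    and "step \<omega> n = 0 \<Longrightarrow> step \<omega> (Suc n) = s \<Longrightarrow> flip s n (flip s n \<omega>) = \<omega>"
    and "step \<omega> n = s \<Longrightarrow> step \<omega> (Suc n) = - s \<Longrightarrow> flip s n (flip s n \<omega>) = \<omega>"
  using step_flip_upper[OF s, of n \<omega>] step_flip_lower[OF s, of n \<omega>] flip_flip[OF s, of n \<omega>]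
  by (auto simp: flip_upper_def flip_lower_def)

text \<open>With concrete signs the simplifier decides every comparison of steps by arithmetic on
  numerals.\<close>

lemmas step_flip_pm = step_flip[of 1, simplified] step_flip[of "-1", simplified]

text \<open>\<open>a\<close>, \<open>c\<close> are the diagonal and \<open>b\<close> the
  off-diagonal entries of the 2 by 2 block: trace 1 and determinant 0 express that it is a rank-one
  projection. The last two products are tau and \<open>lam\<close> times tau.\<close>

lemma flip_proj_coeffs:
  fixes lam :: real
  assumes "lam > 0"
  defines "a \<equiv> 1 / (1 + lam)" and "b \<equiv> sqrt lam / (1 + lam)" and "c \<equiv> lam / (1 + lam)"
  shows "a + c = 1" "b * b = a * c" "lam / (1 + lam)\<^sup>2 = a * c" "lam * (lam / (1 + lam)\<^sup>2) = c * c"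
  using assms(1) by (auto simp: a_def b_def c_def field_simps power2_eq_square)

lemmas flip_proj_ket_pm =
  flip_proj_ket[of 1, unfolded flip_upper_def flip_lower_def, simplified]
  flip_proj_ket[of "-1", unfolded flip_upper_def flip_lower_def, simplified]

lemmas ket_eval_simps = bop_apply_times bop_apply_simps bop_apply_add bop_apply_scaleR
  bop_apply_0_right scaleR_add_right step_flip_pm step_proj_ket

lemma is_projection_flip_proj:
  assumes s: "s = 1 \<or> s = -1" and "lam > 0"
  shows "is_projection (flip_proj lam s n)"
  unfolding is_projection_def
proof
  define a b c where "a = 1 / (1 + lam)" "b = sqrt lam / (1 + lam)" "c = lam / (1 + lam)"
  have abc: "a + c = 1" "b * b = a * c"
    using flip_proj_coeffs[OF \<open>lam > 0\<close>] by (auto simp: a_b_c_def)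
  \<comment> \<open>These are the block applied twice to an upper and to a lower basis vector
    \<open>x\<close> with flip \<open>y\<close>, after \<open>b * b\<close> has become
    \<open>a * c\<close>.\<close>
  have R: "(a * a) *\<^sub>R x + (a * b) *\<^sub>R y + ((b * c) *\<^sub>R y + (a * c) *\<^sub>R x) = a *\<^sub>R x + b *\<^sub>R y"
    "(c * c) *\<^sub>R x + (b * c) *\<^sub>R y + ((a * b) *\<^sub>R y + (a * c) *\<^sub>R x) = c *\<^sub>R x + b *\<^sub>R y"
    for x y :: "path ell2"
  proof -
    have c: "c = 1 - a" using abc(1) by simp
    show "(a * a) *\<^sub>R x + (a * b) *\<^sub>R y + ((b * c) *\<^sub>R y + (a * c) *\<^sub>R x) = a *\<^sub>R x + b *\<^sub>R y"
      "(c * c) *\<^sub>R x + (b * c) *\<^sub>R y + ((a * b) *\<^sub>R y + (a * c) *\<^sub>R x) = c *\<^sub>R x + b *\<^sub>R y"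
      unfolding c by (rule ell2_eqI; simp add: algebra_simps)+
  qed
  show "flip_proj lam s n * flip_proj lam s n = flip_proj lam s n"
  proof (rule bop_eqI_ket)
    fix \<omega>
    show "bop_apply (flip_proj lam s n * flip_proj lam s n) (ket \<omega>) = bop_apply (flip_proj lam s n) (ket \<omega>)"
      using s step_cases[of \<omega> n] step_cases[of \<omega> "Suc n"]
      by (elim disjE)
        (simp_all add: ket_eval_simps flip_proj_ket_pm[of lam, folded a_b_c_def] abc(2) R mult_ac)
  qed
qed (rule adj_flip_proj)

text \<open>In the range of the outer factor step \<open>n + 1\<close> is \<open>s\<close> or
  \<open>- s\<close>, never 0. The middle factor therefore meets only its lower pair (t, -t), which
  forces step \<open>n + 2\<close> to be \<open>- t\<close> and contributes \<open>c\<close>; its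
  off-diagonal part produces step 0 there and is killed. The outer weight of that component is
  \<open>a\<close> if s = t and \<open>c\<close> otherwise.\<close>

lemma flip_proj_sandwich_Suc:
  assumes s: "s = 1 \<or> s = -1" and t: "t = 1 \<or> t = -1" and "lam > 0"
  shows "flip_proj lam s n * flip_proj lam t (Suc n) * flip_proj lam s n =
    ((if s = t then 1 else lam) * (lam / (1 + lam)\<^sup>2)) *\<^sub>R (flip_proj lam s n * step_proj (n + 2) (- t))"
proof (rule bop_eqI_ket)
  define a b c where "a = 1 / (1 + lam)" "b = sqrt lam / (1 + lam)" "c = lam / (1 + lam)"
  note coeff = flip_proj_coeffs[OF \<open>lam > 0\<close>, folded a_b_c_def]
  \<comment> \<open>The second form catches \<open>b * b\<close> inside longer products, which
    \<open>mult_ac\<close> nests to the right.\<close>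
  have abc: "b * b = a * c" "b * (b * x) = a * (c * x)"
    "(if s = t then 1 else lam) * (lam / (1 + lam)\<^sup>2) = (if s = t then a * c else c * c)" for x
    using coeff by (simp_all flip: mult.assoc)
  fix \<omega>
  show "bop_apply (flip_proj lam s n * flip_proj lam t (Suc n) * flip_proj lam s n) (ket \<omega>) =
    bop_apply (((if s = t then 1 else lam) * (lam / (1 + lam)\<^sup>2)) *\<^sub>R
      (flip_proj lam s n * step_proj (n + 2) (- t))) (ket \<omega>)"
    unfolding abc(3) add_2_eq_Suc'
    using s t step_cases[of \<omega> n] step_cases[of \<omega> "Suc n"] step_cases[of \<omega> "Suc (Suc n)"]
    by (elim disjE)
      (simp_all add: ket_eval_simps flip_proj_ket_pm[of lam, folded a_b_c_def] abc(1,2) mult_ac)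
qed

text \<open>Step \<open>n + 1\<close> is now 0 or \<open>t\<close> in the outer range, and the
  middle factor sees only \<open>t\<close>, a component of weight \<open>c\<close>. It is the upper
  pair (0, s) with entry \<open>a\<close> if s = t, and the lower pair (s, -s) with entry
  \<open>c\<close> otherwise. The off-diagonal part turns step \<open>n + 1\<close> into
  \<open>- t\<close> and is killed.\<close>

lemma flip_proj_Suc_sandwich:
  assumes s: "s = 1 \<or> s = -1" and t: "t = 1 \<or> t = -1" and "lam > 0"
  shows "flip_proj lam t (Suc n) * flip_proj lam s n * flip_proj lam t (Suc n) =
    ((if s = t then 1 else lam) * (lam / (1 + lam)\<^sup>2)) *\<^sub>R
      (flip_proj lam t (Suc n) * step_proj n (if s = t then 0 else s))"
proof (rule bop_eqI_ket)
  define a b c where "a = 1 / (1 + lam)" "b = sqrt lam / (1 + lam)" "c = lam / (1 + lam)"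
  note coeff = flip_proj_coeffs[OF \<open>lam > 0\<close>, folded a_b_c_def]
  have abc: "b * b = a * c" "b * (b * x) = a * (c * x)"
    "(if s = t then 1 else lam) * (lam / (1 + lam)\<^sup>2) = (if s = t then a * c else c * c)" for x
    using coeff by (simp_all flip: mult.assoc)
  fix \<omega>
  show "bop_apply (flip_proj lam t (Suc n) * flip_proj lam s n * flip_proj lam t (Suc n)) (ket \<omega>) =
    bop_apply (((if s = t then 1 else lam) * (lam / (1 + lam)\<^sup>2)) *\<^sub>R
      (flip_proj lam t (Suc n) * step_proj n (if s = t then 0 else s))) (ket \<omega>)"
    unfolding abc(3)
    using s t step_cases[of \<omega> n] step_cases[of \<omega> "Suc n"] step_cases[of \<omega> "Suc (Suc n)"]
    by (elim disjE)
      (simp_all add: ket_eval_simps flip_proj_ket_pm[of lam, folded a_b_c_def] abc(1,2) mult_ac)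
qed

text \<open>The pairs (0, s), (s, -s) and (0, -s), (-s, s) are disjoint.\<close>

lemma flip_proj_mult_uminus:
  assumes s: "s = 1 \<or> s = -1"
  shows "flip_proj lam s n * flip_proj lam (- s) n = 0"
proof (rule bop_eqI_ket)
  fix \<omega>
  show "bop_apply (flip_proj lam s n * flip_proj lam (- s) n) (ket \<omega>) = bop_apply 0 (ket \<omega>)"
    using s step_cases[of \<omega> n] step_cases[of \<omega> "Suc n"]
    by (elim disjE) (simp_all add: ket_eval_simps flip_proj_ket_pm)
qed

text \<open>The middle factor either leaves the path unchanged, hence in the support of the right
  factor, or flips it out of that support. In neither case does it reach the support of the left
  factor.\<close>

lemma flip_proj_mult_Suc_uminus:
  assumes s: "s = 1 \<or> s = -1" and t: "t = 1 \<or> t = -1"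
  shows "flip_proj lam s n * flip_proj lam t (Suc n) * flip_proj lam (- s) n = 0" (is "?A = 0")
    and "flip_proj lam t (Suc n) * flip_proj lam s n * flip_proj lam (- t) (Suc n) = 0" (is "?B = 0")
proof -
  have "bop_apply ?A (ket \<omega>) = 0 \<and> bop_apply ?B (ket \<omega>) = 0" for \<omega>
    using s t step_cases[of \<omega> n] step_cases[of \<omega> "Suc n"] step_cases[of \<omega> "Suc (Suc n)"]
    by (elim disjE) (simp_all add: ket_eval_simps flip_proj_ket_pm)
  then show "?A = 0" "?B = 0"
    by (simp_all add: bop_eqI_ket bop_apply_simps)
qed

lemma flip_proj_commute:
  assumes s: "s = 1 \<or> s = -1" and t: "t = 1 \<or> t = -1" and "\<bar>int n - int m\<bar> \<ge> 2"
  shows "flip_proj lam s n * flip_proj lam t m = flip_proj lam t m * flip_proj lam s n"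
proof (rule bop_eqI_ket)
  fix \<omega>
  have nm: "n \<noteq> m" "n \<noteq> Suc m" "m \<noteq> n" "m \<noteq> Suc n" "Suc n \<noteq> m" "Suc m \<noteq> n" using assms(3) by auto
  let ?d = "\<lambda>s n. flip_upper s n \<omega> \<or> flip_lower s n \<omega>"
  \<comment> \<open>A flip at floor \<open>m\<close> alters only the steps \<open>m\<close> and
    \<open>m + 1\<close>, which the test at floor \<open>n\<close> does not inspect.\<close>
  have U: "flip_upper s n (flip t m \<omega>) = flip_upper s n \<omega>" "flip_lower s n (flip t m \<omega>) = flip_lower s n \<omega>"
    if "?d t m"
    using that
    by (auto simp: step_flip_upper[OF t] step_flip_lower[OF t] nm
        flip_upper_def[of s] flip_lower_def[of s])
  have U': "flip_upper t m (flip s n \<omega>) = flip_upper t m \<omega>" "flip_lower t m (flip s n \<omega>) = flip_lower t m \<omega>"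
    if "?d s n"
    using that
    by (auto simp: step_flip_upper[OF s] step_flip_lower[OF s] nm
        flip_upper_def[of t] flip_lower_def[of t])
  have C: "flip s n (flip t m \<omega>) = flip t m (flip s n \<omega>)" if "?d s n" "?d t m"
    using that by (intro coord_eqI) (auto simp: coord_flip_upper[OF s] coord_flip_upper[OF t]
       coord_flip_lower[OF s] coord_flip_lower[OF t] U U')
  show "bop_apply (flip_proj lam s n * flip_proj lam t m) (ket \<omega>) =
      bop_apply (flip_proj lam t m * flip_proj lam s n) (ket \<omega>)"
    by (auto simp: bop_apply_times bop_apply_simps flip_proj_ket[OF s] flip_proj_ket[OF t] U U' C
      bop_apply_add bop_apply_scaleR bop_apply_0_right scaleR_add_right mult_ac add_ac)
qed

section \<open>Membership in the AF algebra\<close>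

lemma truncate_eq_iff: "truncate r \<omega> = truncate r \<omega>' \<longleftrightarrow> (\<forall>m\<le>int r. coord \<omega> m = coord \<omega>' m)"
  by (auto simp: truncate_def fun_eq_iff)

lemma truncate_in_fin_paths: "truncate r \<omega> \<in> fin_paths r"
  using coord_edge[of _ \<omega>] by (auto simp: fin_paths_def truncate_def coord_le_m1)

lemma finite_fin_paths: "finite (fin_paths r)"
proof (rule finite_subset)
  show "fin_paths r \<subseteq> {\<xi>. \<forall>n. (n \<in> {0..int r} \<longrightarrow> \<xi> n \<in> {0..2 ^ r}) \<and> (n \<notin> {0..int r} \<longrightarrow> \<xi> n = 0)}"
  proof (clarify, intro conjI impI)
    fix \<xi> n assume \<xi>: "\<xi> \<in> fin_paths r"
    show "\<xi> n \<in> {0..2 ^ r}" if n: "n \<in> {0..int r}"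
    proof -
      have "edge (n - 1, \<xi> (n - 1)) (n - 1 + 1, \<xi> (n - 1 + 1))"
        using \<xi> n by (intro conjunct2[OF CollectD[OF \<xi>[unfolded fin_paths_def]], rule_format]) auto
      then have "0 \<le> \<xi> n" "\<xi> n \<le> 2 ^ nat n"
        using n by (auto simp: edge_def vertices_def)
      moreover have "(2::int) ^ nat n \<le> 2 ^ r"
        using n by (intro power_increasing) auto
      ultimately show ?thesis by (meson atLeastAtMost_iff order_trans)
    qed
    show "\<xi> n = 0" if "n \<notin> {0..int r}"
      using \<xi> that unfolding fin_paths_def by auto
  qed
  show "finite {\<xi>. \<forall>n. (n \<in> {0..int r} \<longrightarrow> \<xi> n \<in> {0..2 ^ r}) \<and> (n \<notin> {0..int r} \<longrightarrow> \<xi> n = (0::int))}"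
    by (rule finite_set_of_finite_funs) auto
qed

lemma bop_apply_sum: "bop_apply (\<Sum>i\<in>I. A i) x = (\<Sum>i\<in>I. bop_apply (A i) x)"
  by (induction I rule: infinite_finite_induct) (auto simp: bop_apply_simps)

text \<open>Splitting by the initial segment writes \<open>A\<close> as a finite sum of matrix
  units. The tail condition includes \<open>m = int r\<close> because both segments of a matrix unit
  must end at the same vertex.\<close>

lemma finite_algI:
  assumes ket: "\<And>\<omega>. bop_apply A (ket \<omega>) = (if Q \<omega> then ket (h \<omega>) else 0)"
    and Q: "\<And>\<omega> \<omega>'. truncate r \<omega> = truncate r \<omega>' \<Longrightarrow> Q \<omega> \<Longrightarrow> Q \<omega>'"
    and h: "\<And>\<omega> \<omega>'. truncate r \<omega> = truncate r \<omega>' \<Longrightarrow> Q \<omega> \<Longrightarrow> truncate r (h \<omega>) = truncate r (h \<omega>')"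
    and tail: "\<And>\<omega> m. Q \<omega> \<Longrightarrow> m \<ge> int r \<Longrightarrow> coord (h \<omega>) m = coord \<omega> m"
  shows "A \<in> finite_alg r"
proof -
  define T where "T = truncate r ` Collect Q"
  \<comment> \<open>The map induced by \<open>h\<close> on initial segments; by hypothesis
    \<open>h\<close> any representative gives the same value.\<close>
  define H where "H \<eta> = truncate r (h (SOME \<omega>. Q \<omega> \<and> truncate r \<omega> = \<eta>))" for \<eta>
  have H: "H (truncate r \<omega>) = truncate r (h \<omega>)" if "Q \<omega>" for \<omega>
  proof -
    have "Q (SOME \<omega>'. Q \<omega>' \<and> truncate r \<omega>' = truncate r \<omega>) \<and>
        truncate r (SOME \<omega>'. Q \<omega>' \<and> truncate r \<omega>' = truncate r \<omega>) = truncate r \<omega>"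
      by (rule someI[of _ \<omega>]) (use that in simp)
    then show ?thesis unfolding H_def by (intro h) auto
  qed
  have unit: "H \<eta> \<in> fin_paths r" "H \<eta> (int r) = \<eta> (int r)" if "\<eta> \<in> T" for \<eta>
  proof -
    obtain \<omega> where "Q \<omega>" "\<eta> = truncate r \<omega>" using \<open>\<eta> \<in> T\<close> by (auto simp: T_def)
    then show "H \<eta> \<in> fin_paths r" "H \<eta> (int r) = \<eta> (int r)"
      using tail[of \<omega> "int r"] by (simp_all add: H truncate_in_fin_paths) (simp add: truncate_def)
  qed
  have T: "T \<subseteq> fin_paths r" by (auto simp: T_def truncate_in_fin_paths)
  have "A = (\<Sum>\<eta>\<in>T. matrix_unit r (H \<eta>) \<eta>)"
  proof (rule bop_eqI_ket)
    fix \<omega>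
    have "bop_apply (\<Sum>\<eta>\<in>T. matrix_unit r (H \<eta>) \<eta>) (ket \<omega>) =
        (\<Sum>\<eta>\<in>T. if truncate r \<omega> = \<eta> then ket (replace_start r (H \<eta>) \<omega>) else 0)"
      unfolding bop_apply_sum by (intro sum.cong refl matrix_unit_ket unit)
    also have "\<dots> = (if truncate r \<omega> \<in> T then ket (replace_start r (H (truncate r \<omega>)) \<omega>) else 0)"
      by (simp add: sum.delta' finite_subset[OF T finite_fin_paths])
    also have "truncate r \<omega> \<in> T \<longleftrightarrow> Q \<omega>"
      unfolding T_def by (auto intro: Q[OF sym])
    also have "(if Q \<omega> then ket (replace_start r (H (truncate r \<omega>)) \<omega>) else 0) =
        (if Q \<omega> then ket (h \<omega>) else 0)"
    proof (rule if_cong)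
      assume "Q \<omega>"
      then have "coord (replace_start r (truncate r (h \<omega>)) \<omega>) m = coord (h \<omega>) m" for m
        by (subst coord_replace_start[OF truncate_in_fin_paths])
          (use tail[of \<omega>] in \<open>auto simp: truncate_def\<close>)
      then show "ket (replace_start r (H (truncate r \<omega>)) \<omega>) = ket (h \<omega>)"
        unfolding H[OF \<open>Q \<omega>\<close>] by (intro arg_cong[where f = ket] coord_eqI)
    qed simp_all
    finally show "bop_apply A (ket \<omega>) = bop_apply (\<Sum>\<eta>\<in>T. matrix_unit r (H \<eta>) \<eta>) (ket \<omega>)"
      by (simp add: ket)
  qed
  also have "\<dots> \<in> finite_alg r"
    unfolding finite_alg_def cspan_def
    by (intro cvec.span_sum cvec.span_base) (use T unit in blast)
  finally show ?thesis .
qed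

text \<open>Level \<open>Suc n\<close> suffices: the tests read the floors from \<open>n - 1\<close>
  to \<open>n + 1\<close>, and a flip changes only floor \<open>n\<close>. Each of the four summands
  satisfies \<open>finite_algI\<close>.\<close>

lemma flip_proj_in_AF_alg:
  assumes s: "s = 1 \<or> s = -1"
  shows "flip_proj lam s n \<in> AF_alg"
proof -
  let ?V = "flip_op s n" and ?A = "finite_alg (Suc n)"
  note K = flip_op_ket[OF s] adj_flip_op_ket[OF s] bop_apply_times bop_apply_0_right
    flip_lower_flip[OF s] flip_upper_flip[OF s] flip_flip[OF s]
  have up: "flip_upper s n \<omega>'" if "truncate (Suc n) \<omega> = truncate (Suc n) \<omega>'" "flip_upper s n \<omega>" for \<omega> \<omega>'
    using that by (simp add: truncate_eq_iff flip_upper_def step_def)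
  have lo: "flip_lower s n \<omega>'" if "truncate (Suc n) \<omega> = truncate (Suc n) \<omega>'" "flip_lower s n \<omega>" for \<omega> \<omega>'
    using that by (simp add: truncate_eq_iff flip_lower_def step_def)
  have up': "truncate (Suc n) (flip s n \<omega>) = truncate (Suc n) (flip s n \<omega>')"
    if "truncate (Suc n) \<omega> = truncate (Suc n) \<omega>'" "flip_upper s n \<omega>" for \<omega> \<omega>'
    using that up[OF that] by (simp add: truncate_eq_iff coord_flip_upper[OF s])
  have lo': "truncate (Suc n) (flip s n \<omega>) = truncate (Suc n) (flip s n \<omega>')"
    if "truncate (Suc n) \<omega> = truncate (Suc n) \<omega>'" "flip_lower s n \<omega>" for \<omega> \<omega>'
    using that lo[OF that] by (simp add: truncate_eq_iff coord_flip_lower[OF s])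
  have "?V \<in> ?A"
    by (rule finite_algI[OF flip_op_ket[OF s] up up']) (simp_all add: coord_flip_upper[OF s])
  moreover have "adj ?V \<in> ?A"
    by (rule finite_algI[OF adj_flip_op_ket[OF s] lo lo']) (simp_all add: coord_flip_lower[OF s])
  \<comment> \<open>The two products fix the basis paths in their support, hence the identity for
    \<open>h\<close>.\<close>
  moreover have "adj ?V * ?V \<in> ?A"
    by (rule finite_algI[where Q = "flip_upper s n" and h = "\<lambda>\<omega>. \<omega>", OF _ up]) (simp_all add: K)
  moreover have "?V * adj ?V \<in> ?A"
    by (rule finite_algI[where Q = "flip_lower s n" and h = "\<lambda>\<omega>. \<omega>", OF _ lo]) (simp_all add: K)
  ultimately have "flip_proj lam s n \<in> ?A"
    unfolding finite_alg_def cspan_def flip_proj_def scaleR_eq_scaleC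
    by (intro cvec.span_scale cvec.span_add)
  then show ?thesis
    unfolding AF_alg_def by (intro subsetD[OF closure_subset]) blast
qed

theorem proposition14:
  fixes lam tau :: real and E F :: "nat \<Rightarrow> path bop"
  assumes "lam > 0" and "tau = lam / (1 + lam)\<^sup>2"
    and "E = E_op lam" and "F = F_op lam"
  shows "(0 < tau \<and> tau \<le> 1 / 4) \<and>
    (\<forall>n. is_projection (E n) \<and> E n \<in> AF_alg) \<and>
    (\<forall>n\<ge>1. is_projection (F n) \<and> F n \<in> AF_alg) \<and>
    (\<forall>n\<ge>1. E n * F n = 0 \<and> F n * E n = 0) \<and>
    (\<forall>n m. \<bar>int n - int m\<bar> \<ge> 2 \<longrightarrow> commutator (E n) (E m) = 0) \<and>
    (\<forall>n\<ge>1. \<forall>m\<ge>1. \<bar>int n - int m\<bar> \<ge> 2 \<longrightarrow> commutator (F n) (F m) = 0) \<and>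
    (\<forall>n. \<forall>m\<ge>1. \<bar>int n - int m\<bar> \<ge> 2 \<longrightarrow> commutator (E n) (F m) = 0) \<and>
    (\<forall>n. E n * E (n + 1) * E n = tau *\<^sub>R (E n * e_op (n + 2))) \<and>
    (\<forall>n. E (n + 1) * E n * E (n + 1) = tau *\<^sub>R (E (n + 1) * g_op n)) \<and>
    (\<forall>n\<ge>1. F n * F (n + 1) * F n = tau *\<^sub>R (F n * f_op (n + 2))) \<and>
    (\<forall>n\<ge>1. F (n + 1) * F n * F (n + 1) = tau *\<^sub>R (F (n + 1) * g_op n)) \<and>
    (\<forall>n. E n * F (n + 1) * E n = (lam * tau) *\<^sub>R (E n * f_op (n + 2))) \<and>
    (\<forall>n\<ge>1. F n * E (n + 1) * F n = (lam * tau) *\<^sub>R (F n * e_op (n + 2))) \<and>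
    (\<forall>n\<ge>1. E (n + 1) * F n * E (n + 1) = (lam * tau) *\<^sub>R (E (n + 1) * e_op n)) \<and>
    (\<forall>n. F (n + 1) * E n * F (n + 1) = (lam * tau) *\<^sub>R (F (n + 1) * f_op n)) \<and>
    (\<forall>n\<ge>1. E n * E (n + 1) * F n = 0) \<and>
    (\<forall>n\<ge>1. E n * F (n + 1) * F n = 0) \<and>
    (\<forall>n. E (n + 1) * E n * F (n + 1) = 0) \<and>
    (\<forall>n\<ge>1. E (n + 1) * F n * F (n + 1) = 0) \<and>
    (\<forall>n\<ge>1. F n * E (n + 1) * E n = 0) \<and>
    (\<forall>n\<ge>1. F n * F (n + 1) * E n = 0) \<and>
    (\<forall>n. F (n + 1) * E n * E (n + 1) = 0) \<and>
    (\<forall>n\<ge>1. F (n + 1) * F n * E (n + 1) = 0)"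
proof -
  have one: "(1::int) = 1 \<or> (1::int) = -1" and minus_one: "(-1::int) = 1 \<or> (-1::int) = -1" by simp_all
  note eqs = assms(2-4) E_op_eq_flip_proj F_op_eq_flip_proj e_op_eq f_op_eq g_op_eq
  \<comment> \<open>This is the nonnegativity of \<open>(1 - lam)\<^sup>2\<close>.\<close>
  have "4 * lam \<le> (1 + lam)\<^sup>2"
    using zero_le_power2[of "1 - lam"] by (simp add: power2_eq_square algebra_simps)
  then have "0 < tau \<and> tau \<le> 1 / 4"
    using \<open>lam > 0\<close> by (simp add: assms(2) divide_le_eq)
  \<comment> \<open>Sign 1 stands for \<open>E\<close> and sign -1 for \<open>F\<close>; each
    relation is one choice of signs in the lemmas on \<open>flip_proj\<close>.\<close>
  moreover note is_projection_flip_proj[OF one \<open>lam > 0\<close>] is_projection_flip_proj[OF minus_one \<open>lam > 0\<close>]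
    flip_proj_in_AF_alg[OF one, of lam] flip_proj_in_AF_alg[OF minus_one, of lam]
    flip_proj_mult_uminus[OF one, of lam] flip_proj_mult_uminus[OF minus_one, of lam]
    flip_proj_commute[OF one one, of _ _ lam] flip_proj_commute[OF minus_one minus_one, of _ _ lam]
    flip_proj_commute[OF one minus_one, of _ _ lam]
    flip_proj_sandwich_Suc[OF one one \<open>lam > 0\<close>] flip_proj_sandwich_Suc[OF one minus_one \<open>lam > 0\<close>]
    flip_proj_sandwich_Suc[OF minus_one one \<open>lam > 0\<close>] flip_proj_sandwich_Suc[OF minus_one minus_one \<open>lam > 0\<close>]
    flip_proj_Suc_sandwich[OF one one \<open>lam > 0\<close>] flip_proj_Suc_sandwich[OF one minus_one \<open>lam > 0\<close>]
    flip_proj_Suc_sandwich[OF minus_one one \<open>lam > 0\<close>] flip_proj_Suc_sandwich[OF minus_one minus_one \<open>lam > 0\<close>]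
    flip_proj_mult_Suc_uminus[OF one one, of lam] flip_proj_mult_Suc_uminus[OF one minus_one, of lam]
    flip_proj_mult_Suc_uminus[OF minus_one one, of lam] flip_proj_mult_Suc_uminus[OF minus_one minus_one, of lam]
  ultimately show ?thesis
    unfolding eqs commutator_def by simp
qed

end
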